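(* Let $\mathbb F\in\{\mathbb R,\mathbb C\}$ and let $T:\mathcal T_n\to\mathcal T_n$ be an $\mathbb F$-linear map on the space $\mathcal T_n$ of $n\times n$ Toeplitz matrices over $\mathbb F$. Then $T$ preserves rank one matrices in $\mathcal T_n$ (i.e. maps rank one matrices in $\mathcal T_n$ to rank one matrices) if and only if one of the following holds. (a) There are nonzero $\gamma,r\in\mathbb F$ such that $T$ has the form $A\mapsto MAN$ with $M=\gamma F_nN^\top F_n$ and $N$ of one of the following forms: (1) $N=V_n(\alpha)D_n(r)$ for some $\alpha\in\mathbb F$; (2) $N=V_n(\alpha)F_nD_n(r)$ for some $\alpha\in\mathbb F$; (3) $N=W_n(\alpha,\beta)D_n(r)$ for some $\alpha,\beta\in\mathbb F$ with $\alpha\neq\beta$. (b) $\mathbb F=\mathbb R$ and $T$ has the form $A\mapsto f_{\mathbf c}(A)B$ for some rank one matrix $B\in\mathcal T_n$ and some admissible linear functional $f_{\mathbf c}$ on $\mathcal T_n$.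
   Context: A matrix $A\in M_n(\mathbb F)$ is Toeplitz if $A=[a_{i-j}]_{i,j=1}^n$ for some $a_{1-n},\dots,a_{n-1}\in\mathbb F$. Convention: $0^0=1$. $\mathbf e_1$ is the first column of $I_n$; $Z_n$ is the $n\times n$ lower shift matrix (ones on the first subdiagonal, zeros elsewhere); $\mathcal J_\alpha=\alpha I_n+Z_n$. $F_n$ is the $n\times n$ anti-diagonal permutation matrix (ones on the anti-diagonal, zeros elsewhere). $D_n(r)=\mathrm{diag}(1,r,\dots,r^{n-1})$. $V_n(\alpha)=[\mathbf e_1\ \ \mathcal J_\alpha\mathbf e_1\ \cdots\ \mathcal J_\alpha^{n-1}\mathbf e_1]$, i.e. the upper triangular matrix with $(i,j)$ entry $\binom{j-1}{i-1}\alpha^{j-i}$ for $i\le j$. $W_n(\alpha,\beta)$ is the $n\times n$ matrix whose $j$-th column is $\mathcal J_\beta^{n-j}\mathcal J_\alpha^{j-1}\mathbf e_1$, $j=1,\dots,n$. For $\mathbf c=(c_1,\dots,c_{2n-1})\in\mathbb R^{2n-1}$, $f_{\mathbf c}:\mathcal T_n\to\mathbb R$ is the linear functional $f_{\mathbf c}([a_{i-j}])=\sum_{j=1}^{2n-1}c_ja_{n-j}$. It is called admissible if $\sum_{j=0}^{2n-2}c_{j+1}x^j\neq0$ for all $x\in\mathbb R$.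
   Formalization: Admissible is taken to require also c_{2n-1} ≠ 0: as printed, for n ≥ 2 the vector c = (1,0,…,0) is admissible, yet A ↦ f_c(A)B sends the rank one Toeplitz matrix E_{1n} to 0, so (b) would not imply that rank one is preserved. *)

theory Defs
  imports Complex_Main "Jordan_Normal_Form.DL_Rank"
begin

text \<open>
  Rows and columns are indexed from 0, so \<open>A $$ (i, j)\<close> is the usual entry \<open>(i+1, j+1)\<close>; the
  differences \<open>i - j\<close> are unaffected. Powers satisfy \<open>0 ^ 0 = 1\<close>.
\<close>

definition toeplitz_mat :: "nat \<Rightarrow> (int \<Rightarrow> 'a) \<Rightarrow> 'a mat" where
  "toeplitz_mat n a = Matrix.mat n n (\<lambda>(i, j). a (int i - int j))"

definition toeplitz_space :: "nat \<Rightarrow> 'a mat set" where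
  "toeplitz_space n = range (toeplitz_mat n)"

text \<open>Linearity is only required on the Toeplitz matrices; the values of \<open>T\<close> elsewhere are
  irrelevant.\<close>

definition toeplitz_linear :: "nat \<Rightarrow> ('a :: field mat \<Rightarrow> 'a mat) \<Rightarrow> bool" where
  "toeplitz_linear n T \<longleftrightarrow>
     (\<forall>A \<in> toeplitz_space n. T A \<in> toeplitz_space n) \<and>
     (\<forall>A \<in> toeplitz_space n. \<forall>B \<in> toeplitz_space n. T (A + B) = T A + T B) \<and>
     (\<forall>k. \<forall>A \<in> toeplitz_space n. T (k \<cdot>\<^sub>m A) = k \<cdot>\<^sub>m T A)"

definition rank_one :: "nat \<Rightarrow> 'a :: field mat \<Rightarrow> bool" where
  "rank_one n A \<longleftrightarrow> A \<in> carrier_mat n n \<and> vec_space.rank n A = 1"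

definition preserves_rank_one :: "nat \<Rightarrow> ('a :: field mat \<Rightarrow> 'a mat) \<Rightarrow> bool" where
  "preserves_rank_one n T \<longleftrightarrow> (\<forall>A \<in> toeplitz_space n. rank_one n A \<longrightarrow> rank_one n (T A))"

definition shift_mat :: "nat \<Rightarrow> 'a :: field mat" where
  "shift_mat n = Matrix.mat n n (\<lambda>(i, j). if i = Suc j then 1 else 0)"

definition J_mat :: "nat \<Rightarrow> 'a :: field \<Rightarrow> 'a mat" where
  "J_mat n \<alpha> = \<alpha> \<cdot>\<^sub>m 1\<^sub>m n + shift_mat n"

definition F_mat :: "nat \<Rightarrow> 'a :: field mat" where
  "F_mat n = Matrix.mat n n (\<lambda>(i, j). if Suc (i + j) = n then 1 else 0)"

definition D_mat :: "nat \<Rightarrow> 'a :: field \<Rightarrow> 'a mat" where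
  "D_mat n r = mat_diag n (\<lambda>i. r ^ i)"

definition V_mat :: "nat \<Rightarrow> 'a :: field \<Rightarrow> 'a mat" where
  "V_mat n \<alpha> = mat_of_cols n (map (\<lambda>j. (J_mat n \<alpha> ^\<^sub>m j) *\<^sub>v unit_vec n 0) [0..<n])"

text \<open>With 0-based \<open>j\<close>, the exponents \<open>n - j\<close> and \<open>j - 1\<close> of the usual definition become
  \<open>n - 1 - j\<close> and \<open>j\<close>.\<close>

definition W_mat :: "nat \<Rightarrow> 'a :: field \<Rightarrow> 'a \<Rightarrow> 'a mat" where
  "W_mat n \<alpha> \<beta> =
     mat_of_cols n
       (map (\<lambda>j. (J_mat n \<beta> ^\<^sub>m (n - 1 - j) * J_mat n \<alpha> ^\<^sub>m j) *\<^sub>v unit_vec n 0) [0..<n])"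

definition standard_form :: "nat \<Rightarrow> ('a :: field mat \<Rightarrow> 'a mat) \<Rightarrow> bool" where
  "standard_form n T \<longleftrightarrow>
     (\<exists>\<gamma> r M N. \<gamma> \<noteq> 0 \<and> r \<noteq> 0 \<and>
        (\<forall>A \<in> toeplitz_space n. T A = M * A * N) \<and>
        M = \<gamma> \<cdot>\<^sub>m (F_mat n * transpose_mat N * F_mat n) \<and>
        ((\<exists>\<alpha>. N = V_mat n \<alpha> * D_mat n r) \<or>
         (\<exists>\<alpha>. N = V_mat n \<alpha> * F_mat n * D_mat n r) \<or>
         (\<exists>\<alpha> \<beta>. \<alpha> \<noteq> \<beta> \<and> N = W_mat n \<alpha> \<beta> * D_mat n r)))"

text \<open>The entry \<open>a\<^sub>k\<close> of a Toeplitz matrix \<open>[a\<^bsub>i-j\<^esub>]\<close>, read off from its first column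
  (\<open>k \<ge> 0\<close>) or first row (\<open>k < 0\<close>).\<close>

definition diag_entry :: "'a mat \<Rightarrow> int \<Rightarrow> 'a" where
  "diag_entry A k = (if k \<ge> 0 then A $$ (nat k, 0) else A $$ (0, nat (- k)))"

text \<open>A vector \<open>c \<in> \<real>\<^bsup>2n-1\<^esup>\<close> is a function of which only the values at \<open>1, \<dots>, 2n-1\<close> are used.\<close>

definition toeplitz_functional :: "nat \<Rightarrow> (nat \<Rightarrow> real) \<Rightarrow> real mat \<Rightarrow> real" where
  "toeplitz_functional n c A = (\<Sum>j = 1..2 * n - 1. c j * diag_entry A (int n - int j))"

lemma toeplitz_functional_toeplitz_mat:
  assumes "n \<ge> 1"
  shows "toeplitz_functional n c (toeplitz_mat n a) =
    (\<Sum>j = 1..2 * n - 1. c j * a (int n - int j))"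
  unfolding toeplitz_functional_def
proof (rule sum.cong)
  fix j assume "j \<in> {1..2 * n - 1}"
  then show "c j * diag_entry (toeplitz_mat n a) (int n - int j) = c j * a (int n - int j)"
    using assms by (auto simp: diag_entry_def toeplitz_mat_def)
qed simp

text \<open>
  The rank one Toeplitz matrices are the nonzero multiples of \<open>[x\<^bsup>n-1-(i-j)\<^esup>]\<close> for \<open>x \<in> \<real>\<close> and of
  the matrix unit with \<open>a\<^bsub>1-n\<^esub> = 1\<close> in the upper right corner (the point \<open>x = \<infinity>\<close>). On these,
  \<open>f\<^sub>c\<close> takes the values \<open>\<Sum>j\<le>2n-2. c (j + 1) * x ^ j\<close> and \<open>c (2n-1)\<close>. The published definition of
  admissibility only asks the former not to vanish, but the latter is needed too: for \<open>n \<ge> 2\<close> and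
  \<open>c = (1, 0, \<dots>, 0)\<close> the polynomial is the constant 1, while \<open>A \<mapsto> f\<^sub>c(A) B\<close> maps the corner matrix
  unit to 0. The conjunct \<open>c (2 * n - 1) \<noteq> 0\<close> below supplies this missing condition, so that the
  polynomial is nonzero on the whole projective line.
\<close>

definition admissible :: "nat \<Rightarrow> (nat \<Rightarrow> real) \<Rightarrow> bool" where
  "admissible n c \<longleftrightarrow>
     (\<forall>x :: real. (\<Sum>j = 0..2 * n - 2. c (j + 1) * x ^ j) \<noteq> 0) \<and> c (2 * n - 1) \<noteq> 0"

end

theory Submission
  imports Defs "Jordan_Normal_Form.DL_Rank_Submatrix"
    "HOL-Computational_Algebra.Polynomial_Factorial"
    "HOL-Computational_Algebra.Fundamental_Theorem_Algebra"
    "HOL-Computational_Algebra.Field_as_Ring"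
begin

text \<open>
  A Toeplitz matrix has rank one iff its diagonals, read from the bottom left to the top right corner,
  are \<open>c x\<^sup>k y\<^bsup>m-k\<^esup>\<close> with \<open>m = 2n - 2\<close>, \<open>c \<noteq> 0\<close> and \<open>(x, y) \<noteq> 0\<close>: a point of the cone over the rational normal
  curve. Applied to \<open>(x\<^sup>k)\<^sub>k\<close>, a linear map gives polynomials \<open>P\<^sub>0(x), \<dots>, P\<^sub>m(x)\<close> of degree at most \<open>m\<close>. If it
  preserves rank one, then \<open>P\<^sub>0 P\<^bsub>k+1\<^esub> = P\<^sub>1 P\<^sub>k\<close> and \<open>P\<^sub>k\<^sup>2 = P\<^bsub>k-1\<^esub> P\<^bsub>k+1\<^esub>\<close>, and dividing \<open>P\<^sub>0\<close> and \<open>P\<^sub>1\<close> by their gcd yields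
  \<open>P\<^sub>k = h f\<^sup>k g\<^bsup>m-k\<^esup>\<close> with \<open>f, g\<close> coprime. The degree bound leaves two cases. Either \<open>h\<close> is constant and
  \<open>f, g\<close> are independent linear polynomials, so that the map is induced by a Moebius transformation;
  the three forms of \<open>N\<close> correspond to \<open>g\<close> constant, \<open>f\<close> constant, and neither. Or \<open>f, g\<close> are constants
  and the map is the functional with coefficients from \<open>h\<close> times a fixed matrix; here \<open>h\<close> has no root and degree
  \<open>m\<close>, which is impossible over the complex numbers unless \<open>m = 0\<close>.
\<close>

section \<open>Rank one Toeplitz matrices\<close>

text \<open>The generator \<open>v\<close> lists the diagonals \<open>a\<^bsub>n-1\<^esub>, \<dots>, a\<^bsub>1-n\<^esub>\<close> from the bottom left
  corner to the top right one; only \<open>v 0, \<dots>, v (2n-2)\<close> matter.\<close>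

definition toep :: "nat \<Rightarrow> (nat \<Rightarrow> 'a) \<Rightarrow> 'a mat" where
  "toep n v = toeplitz_mat n (\<lambda>d. v (nat (int n - 1 - d)))"

lemma dim_toep [simp]: "dim_row (toep n v) = n" "dim_col (toep n v) = n"
  by (simp_all add: toep_def toeplitz_mat_def)

lemma toep_carrier [simp]: "toep n v \<in> carrier_mat n n"
  by (rule carrier_matI) simp_all

lemma index_toep:
  assumes "i < n" "j < n"
  shows "toep n v $$ (i, j) = v (n - 1 - i + j)"
proof -
  have "nat (int n - 1 - (int i - int j)) = n - 1 - i + j"
    using assms by linarith
  then show ?thesis
    using assms by (simp add: toep_def toeplitz_mat_def)
qed

lemma toep_cong:
  assumes "\<And>k. k \<le> 2 * n - 2 \<Longrightarrow> v k = w k"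
  shows "toep n v = toep n w"
proof (rule eq_matI)
  fix i j assume "i < dim_row (toep n w)" "j < dim_col (toep n w)"
  then show "toep n v $$ (i, j) = toep n w $$ (i, j)"
    using assms[of "n - 1 - i + j"] by (simp add: index_toep)
qed simp_all

lemma toeplitz_space_eq: "toeplitz_space n = range (toep n)"
proof
  have "toeplitz_mat n a = toep n (\<lambda>k. a (int n - 1 - int k))" for a :: "int \<Rightarrow> 'a"
    by (rule eq_matI) (auto simp: index_toep toeplitz_mat_def intro!: arg_cong[of _ _ a])
  then show "toeplitz_space n \<subseteq> range (toep n :: _ \<Rightarrow> 'a mat)"
    unfolding toeplitz_space_def by blast
  show "range (toep n) \<subseteq> toeplitz_space n"
    unfolding toeplitz_space_def by (auto simp: toep_def)
qed

lemma toep_add: "toep n (\<lambda>k. v k + w k) = toep n v + toep n w"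
  by (rule eq_matI) (auto simp: index_toep)

lemma toep_smult: "toep n (\<lambda>k. c * v k) = c \<cdot>\<^sub>m toep n v"
  by (rule eq_matI) (auto simp: index_toep)

section \<open>Two by two minors, rank and geometric generators\<close>

lemma det_2x2:
  assumes A: "A \<in> carrier_mat 2 2"
  shows "det A = A $$ (0, 0) * A $$ (1, 1) - A $$ (0, 1) * A $$ (1, 0)"
proof -
  have minor: "det (mat_delete A i 0) = A $$ (1 - i, 1)" if "i < 2" for i
  proof -
    have "mat_delete A i 0 \<in> carrier_mat 1 1"
      using mat_delete_carrier[OF A, of i 0] by simp
    from det_single[OF this] have "det (mat_delete A i 0) = mat_delete A i 0 $$ (0, 0)" .
    also have "\<dots> = A $$ (1 - i, 1)"
      using A that by (cases "i = 0") (auto simp: mat_delete_def)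
    finally show ?thesis .
  qed
  have "det A = (\<Sum>i<2. A $$ (i, 0) * cofactor A i 0)"
    by (rule laplace_expansion_column[OF A]) simp
  also have "\<dots> = (\<Sum>i<2. A $$ (i, 0) * ((- 1) ^ i * A $$ (1 - i, 1)))"
    by (intro sum.cong refl arg_cong2[of _ _ _ _ "(*)"]) (simp add: cofactor_def minor)
  also have "\<dots> = A $$ (0, 0) * A $$ (1, 1) - A $$ (0, 1) * A $$ (1, 0)"
    by (simp add: numeral_2_eq_2 mult.commute)
  finally show ?thesis .
qed

text \<open>A nonvanishing minor on these rows and columns would be the determinant of a 2x2
  submatrix and so force rank at least 2.\<close>

lemma minor_eq_0_if_rank_le_1:
  fixes A :: "'a :: field mat"
  assumes A: "A \<in> carrier_mat n n" and rank: "vec_space.rank n A \<le> 1"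
    and i: "i < i'" "i' < n" and j: "j < j'" "j' < n"
  shows "A $$ (i, j) * A $$ (i', j') = A $$ (i, j') * A $$ (i', j)"
proof (rule ccontr)
  assume neq: "\<not> ?thesis"
  let ?S = "submatrix A {i, i'} {j, j'}"
  have card: "{a. a < n \<and> (a = p \<or> a = q)} = {p, q}" if "p < q" "q < n" for p q
    using that by auto
  have pick: "pick {p, q} 0 = p" "pick {p, q} (Suc 0) = q" if "p < q" for p q :: nat
  proof -
    show *: "pick {p, q} 0 = p"
      using that by (auto intro!: Least_equality)
    show "pick {p, q} (Suc 0) = q"
      unfolding pick.simps(2) * using that by (intro Least_equality) auto
  qed
  have S: "?S \<in> carrier_mat 2 2"
    using A i j by (auto simp: dim_submatrix card)
  have "?S $$ (a, b) = A $$ (pick {i, i'} a, pick {j, j'} b)" if "a < 2" "b < 2" for a b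
    using that A i j by (subst submatrix_index) (auto simp: card)
  then have "det ?S = A $$ (i, j) * A $$ (i', j') - A $$ (i, j') * A $$ (i', j)"
    using i j by (simp add: det_2x2[OF S] pick del: pick.simps)
  with neq have "det ?S \<noteq> 0"
    by simp
  from vec_space.rank_gt_minor[OF A this] have "2 \<le> vec_space.rank n A"
    using j by (simp add: card)
  with rank show False
    by simp
qed

lemma rank_ge_1:
  fixes A :: "'a :: field mat"
  assumes A: "A \<in> carrier_mat n n" and i: "i < n" and j: "j < n" and nz: "A $$ (i, j) \<noteq> 0"
  shows "vec_space.rank n A \<ge> 1"
proof -
  let ?S = "submatrix A {i} {j}"
  have card: "{a. a < n \<and> a = p} = {p}" if "p < n" for p
    using that by auto
  have S: "?S \<in> carrier_mat 1 1"
    using A i j by (auto simp: dim_submatrix card)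
  have "?S $$ (0, 0) = A $$ (i, j)"
    using A i j submatrix_index_card[of i A j "{i}" "{j}"] by (auto simp: Collect_conv_if)
  then have "det ?S \<noteq> 0"
    using nz S by (simp add: det_single)
  from vec_space.rank_gt_minor[OF A this] show ?thesis
    using j by (simp add: card)
qed

text \<open>The relations between neighbours alone would admit \<open>1, 0, 0, 0, 1\<close>; those through the corner
  entry \<open>v 0\<close> exclude it.\<close>

lemma geometric_progression:
  fixes v :: "nat \<Rightarrow> 'a :: field"
  assumes corner: "\<And>a b. a \<le> N \<Longrightarrow> b \<le> N \<Longrightarrow> v a * v b = v 0 * v (a + b)"
    and adj: "\<And>k. 1 \<le> k \<Longrightarrow> k < 2 * N \<Longrightarrow> v k * v k = v (k - 1) * v (k + 1)"
    and nz: "k0 \<le> 2 * N" "v k0 \<noteq> 0"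
  shows "\<exists>c x y. c \<noteq> 0 \<and> (x \<noteq> 0 \<or> y \<noteq> 0) \<and> (\<forall>k\<le>2 * N. v k = c * (x ^ k * y ^ (2 * N - k)))"
proof (cases "v 0 = 0")
  case True
  have zero: "v k = 0" if "k < 2 * N" for k
    using that
  proof (induction k)
    case (Suc k)
    then show ?case using adj[of "Suc k"] by simp
  qed (rule True)
  with nz have "v (2 * N) \<noteq> 0"
    by (metis le_neq_implies_less)
  \<comment> \<open>The point at infinity, \<open>x = 1\<close> and \<open>y = 0\<close>: because
    \<open>0 ^ 0 = 1\<close>, exactly the last entry survives.\<close>
  moreover have "v k = v (2 * N) * (1 ^ k * 0 ^ (2 * N - k))" if "k \<le> 2 * N" for k
    using that zero[of k] by (cases "k = 2 * N") auto
  ultimately show ?thesis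
    by (metis one_neq_zero)
next
  case False
  let ?q = "v 1 / v 0"
  have low: "v k = v 0 * ?q ^ k" if "k \<le> N" for k
    using that
  proof (induction k)
    case (Suc k)
    have "v 0 * v (Suc k) = v 1 * v k"
      using corner[of 1 k] \<open>Suc k \<le> N\<close> by simp
    then have "v (Suc k) = v 1 * v k / v 0"
      using False by (metis nonzero_mult_div_cancel_left)
    also have "\<dots> = v 0 * ?q ^ Suc k"
      using Suc by (simp add: ac_simps)
    finally show ?case .
  qed simp
  have "v k = v 0 * (?q ^ k * 1 ^ (2 * N - k))" if "k \<le> 2 * N" for k
  proof -
    \<comment> \<open>The corner relations only reach indices up to \<open>N\<close>, so
      \<open>k\<close> is split into two parts that both stay in that range.\<close>
    define a b where "a = min k N" and "b = k - a"
    with that have ab: "k = a + b" "a \<le> N" "b \<le> N"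
      by auto
    have "v 0 * v k = v a * v b"
      using corner[OF ab(2,3)] ab(1) by simp
    also have "\<dots> = (v 0 * ?q ^ a) * (v 0 * ?q ^ b)"
      by (simp only: low[OF ab(2)] low[OF ab(3)])
    also have "\<dots> = v 0 * (v 0 * ?q ^ k)"
      by (simp add: ab(1) power_add ac_simps)
    finally show ?thesis
      using False by (metis mult_cancel_left mult_1_right power_one)
  qed
  with False show ?thesis
    by (metis one_neq_zero)
qed

text \<open>Vanishing minors give the relations of \<open>geometric_progression\<close> with
  \<open>N = n - 1\<close>; conversely a geometric generator factors the matrix into a column times
  a row. The pair \<open>(x, y)\<close> is homogeneous, so that infinity needs no separate
  case.\<close>

lemma rank_one_toep_iff:
  fixes v :: "nat \<Rightarrow> 'a :: field"
  assumes n: "n \<ge> 1"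
  shows "rank_one n (toep n v) \<longleftrightarrow>
    (\<exists>c x y. c \<noteq> 0 \<and> (x \<noteq> 0 \<or> y \<noteq> 0) \<and> (\<forall>k\<le>2 * n - 2. v k = c * (x ^ k * y ^ (2 * n - 2 - k))))"
    (is "_ \<longleftrightarrow> ?R")
proof
  assume "rank_one n (toep n v)"
  then have rank: "vec_space.rank n (toep n v) = 1"
    by (simp add: rank_one_def)
  have minor: "v (n - 1 - i + j) * v (n - 1 - i' + j') = v (n - 1 - i + j') * v (n - 1 - i' + j)"
    if "i < i'" "i' < n" "j < j'" "j' < n" for i i' j j'
    using minor_eq_0_if_rank_le_1[of "toep n v" n i i' j j'] that rank by (simp add: index_toep)
  have "\<exists>k\<le>2 * n - 2. v k \<noteq> 0"
  proof (rule ccontr)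
    assume "\<not> ?thesis"
    then have "toep n v = 0\<^sub>m n n"
      by (intro eq_matI) (auto simp: index_toep)
    with rank show False
      by (simp add: vec_space.rank_0I)
  qed
  then obtain k0 where k0: "k0 \<le> 2 * (n - 1)" "v k0 \<noteq> 0"
    by (auto simp: right_diff_distrib')
  have "\<exists>c x y. c \<noteq> 0 \<and> (x \<noteq> 0 \<or> y \<noteq> 0) \<and>
      (\<forall>k\<le>2 * (n - 1). v k = c * (x ^ k * y ^ (2 * (n - 1) - k)))"
  proof (rule geometric_progression[where ?k0.0 = k0])
    fix a b assume "a \<le> n - 1" "b \<le> n - 1"
    \<comment> \<open>The minor on rows \<open>n - 1 - a\<close>, \<open>n - 1\<close> and columns
      \<open>0\<close>, \<open>b\<close> has \<open>v 0\<close> in its lower left corner; for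
      \<open>a = 0\<close> or \<open>b = 0\<close> it degenerates and the claim is trivial.\<close>
    then show "v a * v b = v 0 * v (a + b)"
      using minor[of "n - 1 - a" "n - 1" 0 b] n
      by (cases "a = 0 \<or> b = 0") (auto simp: mult.commute)
  next
    fix k assume k: "1 \<le> k" "k < 2 * (n - 1)"
    \<comment> \<open>A contiguous 2x2 block with diagonal entries \<open>v k\<close>: it slides up
      the first column until \<open>k = n - 1\<close>, then along the first row.\<close>
    define i where "i = (if k \<le> n - 1 then n - 1 - k else 0)"
    define j where "j = (if k \<le> n - 1 then 0 else k - (n - 1))"
    have "Suc i < n" "Suc j < n" "n - 1 - i + j = k" "n - 1 - Suc i + Suc j = k"
      "n - 1 - i + Suc j = k + 1" "n - 1 - Suc i + j = k - 1"
      using k by (auto simp: i_def j_def)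
    then show "v k * v k = v (k - 1) * v (k + 1)"
      using minor[of i "Suc i" j "Suc j"] by (simp add: mult.commute)
  qed (use k0 in auto)
  then show ?R
    by (simp add: right_diff_distrib')
next
  assume ?R
  then obtain c x y where c: "c \<noteq> 0" and xy: "x \<noteq> 0 \<or> y \<noteq> 0"
    and v: "\<And>k. k \<le> 2 * n - 2 \<Longrightarrow> v k = c * (x ^ k * y ^ (2 * n - 2 - k))"
    by blast
  have entry: "toep n v $$ (i, j) = (c * x ^ (n - 1 - i) * y ^ i) * (x ^ j * y ^ (n - 1 - j))"
    if "i < n" "j < n" for i j
  proof -
    have "2 * n - 2 - (n - 1 - i + j) = i + (n - 1 - j)" "n - 1 - i + j \<le> 2 * n - 2"
      using that by simp_all
    then show ?thesis
      unfolding index_toep[OF that] by (simp only: v power_add ac_simps)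
  qed
  have "vec_space.rank n (toep n v) \<le> 1"
    by (rule vec_space.rank_le_1_product_entries[OF toep_carrier, of _ _ "\<lambda>i. c * x ^ (n - 1 - i) * y ^ i"
      "\<lambda>j. x ^ j * y ^ (n - 1 - j)"]) (simp add: entry)
  \<comment> \<open>The bottom left entry is \<open>c\<close> times a power of \<open>y\<close>, the
    top right one \<open>c\<close> times a power of \<open>x\<close>; one of them is
    nonzero.\<close>
  moreover have "vec_space.rank n (toep n v) \<ge> 1"
  proof (cases "x = 0")
    case True
    then show ?thesis
      using entry[of "n - 1" 0] n c xy by (intro rank_ge_1[OF toep_carrier, of "n - 1" _ 0]) auto
  next
    case False
    then show ?thesis
      using entry[of 0 "n - 1"] n c xy by (intro rank_ge_1[OF toep_carrier, of 0 _ "n - 1"]) auto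
  qed
  ultimately show "rank_one n (toep n v)"
    by (simp add: rank_one_def)
qed

section \<open>Polynomial parametrizations of the rational normal curve\<close>

text \<open>With \<open>g\<close> and \<open>f\<close> the quotients of \<open>P 0\<close> and
  \<open>P 1\<close> by their gcd, the first relation gives
  \<open>P k * g ^ k = P 0 * f ^ k\<close>. At \<open>k = m\<close>, coprimality forces
  \<open>g ^ m\<close> to divide \<open>P 0\<close>, and the quotient is \<open>h\<close>. If
  \<open>P 0 = 0\<close>, only \<open>P m\<close> survives.\<close>

lemma veronese_poly_param:
  fixes P :: "nat \<Rightarrow> 'a :: field_gcd poly"
  assumes first: "\<And>k. k < m \<Longrightarrow> P 0 * P (Suc k) = P 1 * P k"
    and adj: "\<And>k. 1 \<le> k \<Longrightarrow> k < m \<Longrightarrow> P k * P k = P (k - 1) * P (k + 1)"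
    and nz: "k0 \<le> m" "P k0 \<noteq> 0"
  obtains h f g where "h \<noteq> 0" "coprime f g" "\<And>k. k \<le> m \<Longrightarrow> P k = h * f ^ k * g ^ (m - k)"
proof (cases "P 0 = 0")
  case True
  have zero: "P k = 0" if "k < m" for k
    using that
  proof (induction k)
    case (Suc k)
    then show ?case using adj[of "Suc k"] by simp
  qed (rule True)
  with nz have "P m \<noteq> 0"
    by (metis le_neq_implies_less)
  then show ?thesis
  proof (rule that[of _ 1 0])
    show "P k = P m * 1 ^ k * 0 ^ (m - k)" if "k \<le> m" for k
      using that zero[of k] by (cases "k = m") auto
  qed simp
next
  case False
  define d where "d = gcd (P 0) (P 1)"
  have "d \<noteq> 0"
    using False by (simp add: d_def)
  then obtain g f where g: "P 0 = g * d" and f: "P 1 = f * d" and "coprime g f"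
    using gcd_coprime_exists[of "P 0" "P 1"] by (auto simp: d_def)
  then have cop: "coprime f g"
    by (simp add: coprime_commute)
  have "g \<noteq> 0"
    using False g by auto
  have step: "P (Suc k) * g = P k * f" if "k < m" for k
  proof -
    have "d * (P (Suc k) * g) = d * (P k * f)"
      using first[OF that] unfolding f g by (simp only: ac_simps)
    then show ?thesis
      using \<open>d \<noteq> 0\<close> by simp
  qed
  have pow: "P k * g ^ k = P 0 * f ^ k" if "k \<le> m" for k
    using that
  proof (induction k)
    case (Suc k)
    have "P (Suc k) * g ^ Suc k = (P (Suc k) * g) * g ^ k"
      by (simp add: ac_simps)
    also have "\<dots> = (P k * g ^ k) * f"
      using step[of k] Suc.prems by (simp add: ac_simps)
    also have "\<dots> = P 0 * f ^ Suc k"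
      using Suc by (simp add: ac_simps)
    finally show ?case .
  qed simp
  have "g ^ m dvd P 0 * f ^ m"
    using pow[of m] by (metis dvd_triv_right order.refl)
  moreover have "coprime (g ^ m) (f ^ m)"
    using \<open>coprime g f\<close> by simp
  ultimately have "g ^ m dvd P 0"
    by (simp add: coprime_dvd_mult_left_iff)
  then obtain h where h: "P 0 = h * g ^ m"
    by (metis dvd_def mult.commute)
  have "P k = h * f ^ k * g ^ (m - k)" if "k \<le> m" for k
  proof -
    have "P k * g ^ k = h * g ^ (k + (m - k)) * f ^ k"
      using pow[OF that] h that by simp
    also have "\<dots> = (h * f ^ k * g ^ (m - k)) * g ^ k"
      unfolding power_add by (simp only: ac_simps)
    finally show ?thesis
      using \<open>g \<noteq> 0\<close> by simp
  qed
  then show ?thesis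
    using that[of h f g] h False cop by auto
qed

text \<open>For nonzero \<open>f\<close> and \<open>g\<close>, the bound
  \<open>degree h + m * degree f \<le> m\<close>, and likewise for \<open>g\<close>, leaves no room
  for \<open>h\<close> once one of them has degree 1. If one is zero, coprimality makes the other a
  unit.\<close>

lemma veronese_degree_cases:
  fixes f g h :: "'a :: field_gcd poly"
  assumes "h \<noteq> 0" "coprime f g" "m \<ge> 1" "degree (h * f ^ m) \<le> m" "degree (h * g ^ m) \<le> m"
  shows "degree h = 0 \<and> degree f \<le> 1 \<and> degree g \<le> 1 \<or> degree f = 0 \<and> degree g = 0"
proof (cases "f = 0 \<or> g = 0")
  case True
  then show ?thesis
    using assms(2) by (auto simp: is_unit_iff_degree elim!: is_unit_polyE)
next
  case False
  then have "degree h + m * degree f \<le> m" "degree h + m * degree g \<le> m"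
    using assms by (simp_all add: degree_mult_eq degree_power_eq)
  moreover from this have "m * degree f \<le> m * 1" "m * degree g \<le> m * 1"
    by linarith+
  then have "degree f \<le> 1" "degree g \<le> 1"
    using assms(3) by (simp_all only: mult_le_cancel1)
  moreover have "degree h = 0" if "degree p = 1" "degree h + m * degree p \<le> m" for p :: "'a poly"
    using that by simp
  ultimately show ?thesis
    by (metis One_nat_def le_Suc_eq le_zero_eq)
qed

text \<open>A zero determinant makes the polynomials proportional, so a nonconstant one among them
  would be a common divisor.\<close>

lemma coprime_linear_polys:
  fixes a b c d :: "'a :: field_gcd"
  assumes "coprime [:b, a:] [:d, c:]" "a \<noteq> 0 \<or> c \<noteq> 0"
  shows "a * d \<noteq> b * c"
proof
  assume eq: "a * d = b * c"
  show False
  proof (cases "a = 0")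
    case False
    then have "[:d, c:] = smult (c / a) [:b, a:]"
      using eq by (simp add: field_simps)
    then have "[:b, a:] dvd [:d, c:]"
      by (metis dvd_refl dvd_smult)
    then have "is_unit [:b, a:]"
      using assms(1) by (metis coprime_common_divisor dvd_refl)
    then show False
      using False by (simp add: is_unit_iff_degree)
  next
    case True
    then have "c \<noteq> 0" "b = 0"
      using eq assms(2) by auto
    then have "is_unit [:d, c:]"
      using assms(1) True by simp
    then show False
      using \<open>c \<noteq> 0\<close> by (simp add: is_unit_iff_degree)
  qed
qed

section \<open>Linear maps on Toeplitz matrices\<close>

text \<open>Generators are functions on all naturals; the last conjunct makes \<open>L\<close> a
  functional on the space of their first \<open>m + 1\<close> values.\<close>

definition coord_linear :: "nat \<Rightarrow> ((nat \<Rightarrow> 'a :: comm_ring_1) \<Rightarrow> 'a) \<Rightarrow> bool" where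
  "coord_linear m L \<longleftrightarrow>
     (\<forall>v w. L (\<lambda>k. v k + w k) = L v + L w) \<and> (\<forall>c v. L (\<lambda>k. c * v k) = c * L v) \<and>
     (\<forall>v w. (\<forall>k\<le>m. v k = w k) \<longrightarrow> L v = L w)"

lemma coord_linear_expand:
  assumes L: "coord_linear m L"
  shows "L v = (\<Sum>j\<le>m. v j * L (\<lambda>k. if k = j then 1 else 0))"
proof -
  have add: "L (\<lambda>k. v k + w k) = L v + L w" and smult: "L (\<lambda>k. c * v k) = c * L v"
    and cong: "(\<And>k. k \<le> m \<Longrightarrow> v k = w k) \<Longrightarrow> L v = L w" for c v w
    using L unfolding coord_linear_def by blast+
  have trunc: "L (\<lambda>k. if k < s then v k else 0) = (\<Sum>j<s. v j * L (\<lambda>k. if k = j then 1 else 0))" for s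
  proof (induction s)
    case 0
    show ?case
      using smult[of 0 "\<lambda>_. 0"] by simp
  next
    case (Suc s)
    have "(\<lambda>k. if k < Suc s then v k else 0) =
        (\<lambda>k. (if k < s then v k else 0) + v s * (if k = s then 1 else 0))"
      by (auto simp: fun_eq_iff less_Suc_eq)
    then show ?case
      using Suc by (simp add: add smult)
  qed
  have "L v = L (\<lambda>k. if k < Suc m then v k else 0)"
    by (rule cong) simp
  then show ?thesis
    using trunc[of "Suc m"] by (simp add: lessThan_Suc_atMost)
qed

lemma poly_sum_monom:
  "poly (\<Sum>j\<le>m. monom (c j) j) (x :: 'a :: comm_semiring_1) = (\<Sum>j\<le>m. c j * x ^ j)"
  by (simp add: poly_sum poly_monom)

lemma coeff_sum_monom: "coeff (\<Sum>j\<le>m. monom (c j) j) k = (if k \<le> m then c k else 0)"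
  by (simp add: coeff_sum)

lemma degree_sum_monom: "degree (\<Sum>j\<le>m. monom (c j) j) \<le> m"
  by (rule degree_le) (simp add: coeff_sum_monom)

text \<open>The geometric generators span: the value at \<open>x ^ k\<close> is a polynomial in
  \<open>x\<close> whose coefficients are the values on the unit vectors, and over an infinite field
  a polynomial function determines its coefficients.\<close>

lemma coord_linear_eqI:
  fixes L L' :: "(nat \<Rightarrow> 'a :: field_char_0) \<Rightarrow> 'a"
  assumes L: "coord_linear m L" and L': "coord_linear m L'"
    and eq: "\<And>x. L (\<lambda>k. x ^ k) = L' (\<lambda>k. x ^ k)"
  shows "L v = L' v"
proof -
  define p where "p K = (\<Sum>j\<le>m. monom (K (\<lambda>k. if k = j then 1 else 0) :: 'a) j)"
    for K :: "(nat \<Rightarrow> 'a) \<Rightarrow> 'a"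
  have poly: "poly (p K) x = K (\<lambda>k. x ^ k)" if "coord_linear m K" for K x
    unfolding p_def poly_sum_monom by (subst coord_linear_expand[OF that]) (simp add: mult.commute)
  have "poly (p L) = poly (p L')"
    by (rule ext) (simp add: poly L L' eq)
  then have "p L = p L'"
    by (simp only: poly_eq_poly_eq_iff)
  moreover have "coeff (p K) j = K (\<lambda>k. if k = j then 1 else 0)" if "j \<le> m" for K j
    using that by (simp add: p_def coeff_sum_monom)
  ultimately have "L (\<lambda>k. if k = j then 1 else 0) = L' (\<lambda>k. if k = j then 1 else 0)" if "j \<le> m" for j
    using that by metis
  then show ?thesis
    by (simp add: coord_linear_expand[OF L, of v] coord_linear_expand[OF L', of v])
qed

section \<open>Toeplitz-linear maps in coordinates\<close>

lemma toeplitz_linear_carrier: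
  assumes "toeplitz_linear n T"
  shows "T (toep n v) \<in> carrier_mat n n"
proof -
  have "T (toep n v) \<in> range (toep n)"
    using assms by (auto simp: toeplitz_linear_def toeplitz_space_eq)
  then show ?thesis
    by auto
qed

lemma coord_linear_toeplitz_linear:
  assumes T: "toeplitz_linear n T" and ij: "i < n" "j < n"
  shows "coord_linear (2 * n - 2) (\<lambda>v. T (toep n v) $$ (i, j))"
  unfolding coord_linear_def
proof (intro conjI allI impI)
  fix v w :: "nat \<Rightarrow> 'a" and c
  have "T (toep n v + toep n w) = T (toep n v) + T (toep n w)"
    "T (c \<cdot>\<^sub>m toep n v) = c \<cdot>\<^sub>m T (toep n v)"
    using T by (auto simp: toeplitz_linear_def toeplitz_space_eq)
  then show "T (toep n (\<lambda>k. v k + w k)) $$ (i, j) = T (toep n v) $$ (i, j) + T (toep n w) $$ (i, j)"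
    "T (toep n (\<lambda>k. c * v k)) $$ (i, j) = c * T (toep n v) $$ (i, j)"
    using ij toeplitz_linear_carrier[OF T, of v] toeplitz_linear_carrier[OF T, of w]
    by (auto simp: toep_add toep_smult)
next
  fix v w :: "nat \<Rightarrow> 'a"
  assume "\<forall>k\<le>2 * n - 2. v k = w k"
  then have "toep n v = toep n w"
    by (intro toep_cong) auto
  then show "T (toep n v) $$ (i, j) = T (toep n w) $$ (i, j)"
    by simp
qed

lemma toeplitz_linear_expand:
  assumes T: "toeplitz_linear n T"
  obtains t where "\<And>v. T (toep n v) = toep n (\<lambda>k. \<Sum>j\<le>2 * n - 2. v j * t j k)"
proof -
  have "\<forall>j. \<exists>u. T (toep n (\<lambda>k. if k = j then 1 else 0)) = toep n u"
    using T by (auto simp: toeplitz_linear_def toeplitz_space_eq)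
  then obtain t where t: "\<And>j. T (toep n (\<lambda>k. if k = j then 1 else 0)) = toep n (t j)"
    by metis
  have "T (toep n v) = toep n (\<lambda>k. \<Sum>j\<le>2 * n - 2. v j * t j k)" for v
  proof (rule eq_matI)
    fix p q assume "p < dim_row (toep n (\<lambda>k. \<Sum>j\<le>2 * n - 2. v j * t j k))"
      "q < dim_col (toep n (\<lambda>k. \<Sum>j\<le>2 * n - 2. v j * t j k))"
    then have pq: "p < n" "q < n"
      by simp_all
    show "T (toep n v) $$ (p, q) = toep n (\<lambda>k. \<Sum>j\<le>2 * n - 2. v j * t j k) $$ (p, q)"
      by (subst coord_linear_expand[OF coord_linear_toeplitz_linear[OF T pq]])
        (simp add: t index_toep pq)
  qed (use toeplitz_linear_carrier[OF T, of v] in auto)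
  then show thesis
    by (rule that)
qed

text \<open>The affine points \<open>(x, 1)\<close> determine the polynomials \<open>P k\<close> and
  show that \<open>h\<close> has no root; the remaining point \<open>(1, 0)\<close> shows that its
  coefficient of degree \<open>2 * n - 2\<close> is nonzero.\<close>

lemma preserves_rank_one_cases:
  fixes T :: "'a :: {field_char_0, field_gcd} mat \<Rightarrow> 'a mat"
  assumes n: "n \<ge> 1" and T: "toeplitz_linear n T" and pres: "preserves_rank_one n T"
  obtains (moebius) \<kappa> a b c d where "\<kappa> \<noteq> 0" "a * d \<noteq> b * c"
      "\<And>x. T (toep n (\<lambda>k. x ^ k)) =
        toep n (\<lambda>k. \<kappa> * ((a * x + b) ^ k * (c * x + d) ^ (2 * n - 2 - k)))"
  | (functional) h B where "n \<ge> 2" "degree h \<le> 2 * n - 2" "coeff h (2 * n - 2) \<noteq> 0"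
      "\<And>x. poly h x \<noteq> 0" "B \<in> toeplitz_space n" "rank_one n B"
      "\<And>v. T (toep n v) = (\<Sum>j\<le>2 * n - 2. v j * coeff h j) \<cdot>\<^sub>m B"
proof -
  let ?m = "2 * n - 2"
  obtain t where t: "\<And>v. T (toep n v) = toep n (\<lambda>k. \<Sum>j\<le>?m. v j * t j k)"
    using toeplitz_linear_expand[OF T] by blast
  have image: "\<exists>c x' y'. c \<noteq> 0 \<and> (x' \<noteq> 0 \<or> y' \<noteq> 0) \<and>
      (\<forall>k\<le>?m. (\<Sum>j\<le>?m. x ^ j * y ^ (?m - j) * t j k) = c * (x' ^ k * y' ^ (?m - k)))"
    if "x \<noteq> 0 \<or> y \<noteq> 0" for x y
  proof -
    have "rank_one n (toep n (\<lambda>k. x ^ k * y ^ (?m - k)))"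
      unfolding rank_one_toep_iff[OF n] using that
      by (intro exI[of _ 1] exI[of _ x] exI[of _ y]) simp
    then have "rank_one n (T (toep n (\<lambda>k. x ^ k * y ^ (?m - k))))"
      using pres by (auto simp: preserves_rank_one_def toeplitz_space_eq)
    then show ?thesis
      unfolding t rank_one_toep_iff[OF n] .
  qed
  define P where "P k = (\<Sum>j\<le>?m. monom (t j k) j)" for k
  have poly_P: "poly (P k) x = (\<Sum>j\<le>?m. x ^ j * t j k)" for k x
    by (simp add: P_def poly_sum_monom mult.commute)
  have coeff_P: "coeff (P k) j = t j k" if "j \<le> ?m" for j k
    using that by (simp add: P_def coeff_sum_monom)
  have deg_P: "degree (P k) \<le> ?m" for k
    by (simp add: P_def degree_sum_monom)
  have T_pow: "T (toep n (\<lambda>k. x ^ k)) = toep n (\<lambda>k. poly (P k) x)" for x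
    by (simp add: t poly_P)
  have vals: "\<exists>c x' y'. c \<noteq> 0 \<and> (x' \<noteq> 0 \<or> y' \<noteq> 0) \<and>
      (\<forall>k\<le>?m. poly (P k) x = c * (x' ^ k * y' ^ (?m - k)))" for x
    using image[of x 1] by (simp add: poly_P)
  have nonzero: "\<exists>k\<le>?m. c * (x' ^ k * y' ^ (?m - k)) \<noteq> 0"
    if "c \<noteq> 0" "x' \<noteq> 0 \<or> y' \<noteq> 0" for c x' y' :: 'a
    using that by (cases "x' = 0") (auto intro: exI[of _ 0] exI[of _ ?m])
  have nz: "\<exists>k\<le>?m. poly (P k) x \<noteq> 0" for x
    using vals[of x] nonzero by metis
  \<comment> \<open>At \<open>(1, 0)\<close> only the summand with \<open>j = ?m\<close> survives,
    again by \<open>0 ^ 0 = 1\<close>.\<close>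
  have inf: "\<exists>k\<le>?m. t ?m k \<noteq> 0"
  proof -
    have "(\<Sum>j\<le>?m. 1 ^ j * 0 ^ (?m - j) * t j k) = t ?m k" for k
      by (subst sum.remove[of _ ?m]) (auto intro!: sum.neutral)
    then obtain c x' y' where "c \<noteq> 0" "x' \<noteq> 0 \<or> y' \<noteq> 0"
      and t': "\<And>k. k \<le> ?m \<Longrightarrow> t ?m k = c * (x' ^ k * y' ^ (?m - k))"
      using image[of 1 0] by auto
    then obtain k where "k \<le> ?m" "c * (x' ^ k * y' ^ (?m - k)) \<noteq> 0"
      using nonzero by blast
    then show ?thesis
      using t' by metis
  qed
  show thesis
  proof (cases "n = 1")
    \<comment> \<open>Here \<open>?m = 0\<close> and the degree bounds carry no information, but a
      nonzero scalar is already induced by the identity Moebius map.\<close>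
    case True
    then obtain \<kappa> where \<kappa>: "P 0 = [:\<kappa>:]"
      using deg_P[of 0] degree_eq_zeroE[of "P 0"] by auto
    then have "\<kappa> \<noteq> 0"
      using nz[of 0] True by auto
    show thesis
    proof (rule moebius[of \<kappa> 1 1 0 0])
      fix x show "T (toep n (\<lambda>k. x ^ k)) =
          toep n (\<lambda>k. \<kappa> * ((1 * x + 0) ^ k * (0 * x + 1) ^ (2 * n - 2 - k)))"
        unfolding T_pow by (rule toep_cong) (use \<kappa> True in auto)
    qed (use \<open>\<kappa> \<noteq> 0\<close> in auto)
  next
    case False
    with n have n2: "n \<ge> 2"
      by simp
    obtain k0 where k0: "k0 \<le> ?m" "P k0 \<noteq> 0"
      using nz[of 0] by (metis poly_0)
    \<comment> \<open>The relation holds at every point because the values there are geometric; the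
      field being infinite, it holds between polynomials.\<close>
    have first: "P 0 * P (Suc k) = P 1 * P k" if "k < ?m" for k
    proof -
      have "poly (P 0 * P (Suc k)) x = poly (P 1 * P k) x" for x
      proof -
        obtain c x' y' where *: "\<And>k. k \<le> ?m \<Longrightarrow> poly (P k) x = c * (x' ^ k * y' ^ (?m - k))"
          using vals[of x] by blast
        obtain e where m: "?m = Suc (k + e)"
          using less_imp_Suc_add[OF \<open>k < ?m\<close>] by blast
        then have e: "?m - 0 = Suc (k + e)" "?m - Suc k = e" "?m - 1 = k + e" "?m - k = Suc e"
          by linarith+
        have "poly (P 0) x = c * (x' ^ 0 * y' ^ (?m - 0))"
          "poly (P 1) x = c * (x' ^ 1 * y' ^ (?m - 1))"
          "poly (P k) x = c * (x' ^ k * y' ^ (?m - k))"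
          "poly (P (Suc k)) x = c * (x' ^ Suc k * y' ^ (?m - Suc k))"
          using m by (intro *; simp)+
        then show ?thesis
          unfolding poly_mult e by (simp add: power_add)
      qed
      then show ?thesis
        by (simp add: poly_eq_poly_eq_iff[symmetric] fun_eq_iff)
    qed
    have adj: "P k * P k = P (k - 1) * P (k + 1)" if "1 \<le> k" "k < ?m" for k
    proof -
      have "poly (P k * P k) x = poly (P (k - 1) * P (k + 1)) x" for x
      proof -
        obtain c x' y' where *: "\<And>k. k \<le> ?m \<Longrightarrow> poly (P k) x = c * (x' ^ k * y' ^ (?m - k))"
          using vals[of x] by blast
        obtain i where i: "k = Suc i"
          using \<open>1 \<le> k\<close> by (cases k) auto
        obtain e where m: "?m = Suc (k + e)"
          using less_imp_Suc_add[OF \<open>k < ?m\<close>] by blast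
        have e: "?m - k = Suc e" "?m - (k + 1) = e" "?m - (k - 1) = Suc (Suc e)"
          using m i by linarith+
        have "poly (P k) x = c * (x' ^ k * y' ^ (?m - k))"
          "poly (P (k - 1)) x = c * (x' ^ (k - 1) * y' ^ (?m - (k - 1)))"
          "poly (P (k + 1)) x = c * (x' ^ (k + 1) * y' ^ (?m - (k + 1)))"
          using that by (intro *; simp)+
        then show ?thesis
          unfolding poly_mult e by (simp add: i)
      qed
      then show ?thesis
        by (simp add: poly_eq_poly_eq_iff[symmetric] fun_eq_iff)
    qed
    obtain h f g where h: "h \<noteq> 0" and cop: "coprime f g"
      and P: "\<And>k. k \<le> ?m \<Longrightarrow> P k = h * f ^ k * g ^ (?m - k)"
      using veronese_poly_param[of ?m P k0] first adj k0 by blast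
    have "degree (h * f ^ ?m) \<le> ?m" "degree (h * g ^ ?m) \<le> ?m"
      using P[of 0] P[of ?m] deg_P[of 0] deg_P[of ?m] by simp_all
    moreover have "?m \<ge> 1"
      using n2 by linarith
    ultimately have "degree h = 0 \<and> degree f \<le> 1 \<and> degree g \<le> 1 \<or> degree f = 0 \<and> degree g = 0"
      by (intro veronese_degree_cases[OF h cop])
    \<comment> \<open>The overlap of the alternatives is assigned to the second one: in the first,
      some nonconstant factor is needed for a nonzero determinant.\<close>
    then consider "degree h = 0" "degree f \<le> 1" "degree g \<le> 1" "degree f \<noteq> 0 \<or> degree g \<noteq> 0"
      | "degree f = 0" "degree g = 0"
      by argo
    then show thesis
    proof cases
      case 1
      then obtain \<kappa> where \<kappa>: "h = [:\<kappa>:]"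
        by (auto elim: degree_eq_zeroE)
      have linear: "p = [:coeff p 0, coeff p 1:]" if "degree p \<le> 1" for p :: "'a poly"
        using that by (intro poly_eqI) (auto simp: coeff_pCons coeff_eq_0 split: nat.splits)
      obtain a b c d where f: "f = [:b, a:]" and g: "g = [:d, c:]"
        using linear 1 by blast
      show thesis
      proof (rule moebius[of \<kappa> a d b c])
        show "a * d \<noteq> b * c"
          using cop 1(4) by (intro coprime_linear_polys) (auto simp: f g split: if_splits)
        fix x show "T (toep n (\<lambda>k. x ^ k)) =
            toep n (\<lambda>k. \<kappa> * ((a * x + b) ^ k * (c * x + d) ^ (?m - k)))"
          unfolding T_pow by (rule toep_cong) (simp add: P \<kappa> f g algebra_simps)
      qed (use h \<kappa> in auto)
    next
      case 2
      then obtain p q where f: "f = [:p:]" and g: "g = [:q:]"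
        by (metis degree_eq_zeroE)
      let ?b = "\<lambda>k. p ^ k * q ^ (?m - k)"
      \<comment> \<open>All \<open>P k\<close> are multiples of the one polynomial \<open>h\<close>,
        so the image of \<open>T\<close> lies on the line through \<open>toep n ?b\<close>.\<close>
      have Pk: "P k = smult (?b k) h" if "k \<le> ?m" for k
        by (simp add: P[OF that] f g mult.commute poly_const_pow)
      have pq: "p \<noteq> 0 \<or> q \<noteq> 0"
        using cop by (auto simp: f g)
      show thesis
      proof (rule functional[of h "toep n ?b"])
        obtain k where k: "k \<le> ?m" "?b k \<noteq> 0"
          using nonzero[of 1 p q] pq by auto
        then have "degree (P k) = degree h"
          by (simp only: Pk degree_smult_eq if_False)
        then show "degree h \<le> ?m"
          using deg_P[of k] by simp
        show "coeff h ?m \<noteq> 0"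
          using inf coeff_P[of ?m] Pk by (metis coeff_smult mult_zero_right order.refl)
        show "poly h x \<noteq> 0" for x
          using nz[of x] Pk by (metis mult_zero_right poly_smult)
        show "rank_one n (toep n ?b)"
          unfolding rank_one_toep_iff[OF n] using pq
          by (intro exI[of _ 1] exI[of _ p] exI[of _ q]) simp
        show "T (toep n v) = (\<Sum>j\<le>?m. v j * coeff h j) \<cdot>\<^sub>m toep n ?b" for v
          unfolding t toep_smult[symmetric]
        proof (rule toep_cong)
          fix k assume k: "k \<le> ?m"
          have "(\<Sum>j\<le>?m. v j * t j k) = (\<Sum>j\<le>?m. v j * coeff h j * ?b k)"
            by (intro sum.cong refl) (simp add: coeff_P[symmetric] Pk[OF k] ac_simps)
          then show "(\<Sum>j\<le>?m. v j * t j k) = (\<Sum>j\<le>?m. v j * coeff h j) * ?b k"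
            by (simp add: sum_distrib_right)
        qed
      qed (use n2 in \<open>auto simp: toeplitz_space_eq\<close>)
    qed
  qed
qed

section \<open>The standard forms\<close>

lemma index_mult_mat_sum:
  assumes "A \<in> carrier_mat n n" "B \<in> carrier_mat n n" "i < n" "j < n"
  shows "(A * B) $$ (i, j) = (\<Sum>k<n. A $$ (i, k) * B $$ (k, j))"
  using assms by (simp add: scalar_prod_def lessThan_atLeast0)

lemma F_mat_carrier [simp]: "F_mat n \<in> carrier_mat n n"
  by (simp add: F_mat_def)

lemma index_F_mat_mult:
  assumes A: "A \<in> carrier_mat n n" and ij: "i < n" "j < n"
  shows "(F_mat n * A) $$ (i, j) = A $$ (n - 1 - i, j)"
proof -
  have "(F_mat n * A) $$ (i, j) = (\<Sum>k<n. (if Suc (i + k) = n then 1 else 0) * A $$ (k, j))"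
    using ij by (subst index_mult_mat_sum[OF F_mat_carrier A]) (auto simp: F_mat_def)
  also have "\<dots> = (\<Sum>k<n. if n - 1 - i = k then A $$ (k, j) else 0)"
    using ij by (intro sum.cong) auto
  also have "\<dots> = A $$ (n - 1 - i, j)"
    using ij by (simp add: sum.delta')
  finally show ?thesis .
qed

lemma index_mult_F_mat:
  assumes A: "A \<in> carrier_mat n n" and ij: "i < n" "j < n"
  shows "(A * F_mat n) $$ (i, j) = A $$ (i, n - 1 - j)"
proof -
  have "(A * F_mat n) $$ (i, j) = (\<Sum>k<n. A $$ (i, k) * (if Suc (k + j) = n then 1 else 0))"
    using ij by (subst index_mult_mat_sum[OF A F_mat_carrier]) (auto simp: F_mat_def)
  also have "\<dots> = (\<Sum>k<n. if n - 1 - j = k then A $$ (i, k) else 0)"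
    using ij by (intro sum.cong) auto
  also have "\<dots> = A $$ (i, n - 1 - j)"
    using ij by (simp add: sum.delta')
  finally show ?thesis .
qed

lemma D_mat_carrier [simp]: "D_mat n r \<in> carrier_mat n n"
  by (simp add: D_mat_def)

lemma index_mult_D_mat:
  assumes A: "A \<in> carrier_mat n n" and ij: "i < n" "j < n"
  shows "(A * D_mat n r) $$ (i, j) = A $$ (i, j) * r ^ j"
  using ij by (simp add: D_mat_def mat_diag_mult_right[OF A] mult.commute)

lemma J_mat_carrier [simp]: "J_mat n \<alpha> \<in> carrier_mat n n"
  by (auto simp: J_mat_def shift_mat_def)

text \<open>On coefficient vectors, \<open>J_mat\<close> acts as multiplication by the linear
  polynomial modulo the \<open>n\<close>-th power of the variable. This turns the columns of
  \<open>V_mat\<close> and \<open>W_mat\<close> into products of powers of linear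
  polynomials.\<close>

lemma J_mat_mult_vec_coeff:
  "J_mat n \<alpha> *\<^sub>v vec n (coeff p) = vec n (coeff ([:\<alpha>, 1:] * p))"
proof (rule eq_vecI)
  fix i assume "i < dim_vec (vec n (coeff ([:\<alpha>, 1:] * p)))"
  then have i: "i < n"
    by simp
  have "(J_mat n \<alpha> *\<^sub>v vec n (coeff p)) $ i = (\<Sum>k<n. J_mat n \<alpha> $$ (i, k) * coeff p k)"
    using i carrier_matD[OF J_mat_carrier[of n \<alpha>]] by (simp add: scalar_prod_def lessThan_atLeast0)
  also have "\<dots> = (\<Sum>k<n. (if k = i then \<alpha> * coeff p k else 0) +
      (if i = Suc k then coeff p k else 0))"
    using i by (intro sum.cong) (auto simp: J_mat_def shift_mat_def)
  also have "\<dots> = \<alpha> * coeff p i + (case i of 0 \<Rightarrow> 0 | Suc k \<Rightarrow> coeff p k)"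
    using i by (cases i) (auto simp: sum.distrib)
  also have "\<dots> = coeff ([:\<alpha>, 1:] * p) i"
    by (simp add: coeff_pCons split: nat.split)
  finally show "(J_mat n \<alpha> *\<^sub>v vec n (coeff p)) $ i = vec n (coeff ([:\<alpha>, 1:] * p)) $ i"
    using i by simp
qed (simp add: J_mat_def shift_mat_def)

lemma J_mat_pow_mult_vec_coeff:
  "(J_mat n \<alpha> ^\<^sub>m k) *\<^sub>v vec n (coeff p) = vec n (coeff ([:\<alpha>, 1:] ^ k * p))"
proof (induction k arbitrary: p)
  case 0
  show ?case
    by simp (simp add: J_mat_def shift_mat_def)
next
  case (Suc k)
  have "(J_mat n \<alpha> ^\<^sub>m Suc k) *\<^sub>v vec n (coeff p) =
      (J_mat n \<alpha> ^\<^sub>m k) *\<^sub>v (J_mat n \<alpha> *\<^sub>v vec n (coeff p))"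
    by (simp add: assoc_mult_mat_vec[of _ n n _ n])
  then show ?case
    by (simp only: J_mat_mult_vec_coeff Suc power_Suc2 mult.assoc)
qed

lemma unit_vec_0_eq_coeff: "unit_vec n 0 = vec n (coeff 1)"
  by (auto simp: unit_vec_def)

lemma V_mat_carrier [simp]: "V_mat n \<alpha> \<in> carrier_mat n n"
  unfolding V_mat_def using mat_of_cols_carrier(1)[of n "map _ [0..<n]"] by simp

lemma W_mat_carrier [simp]: "W_mat n \<alpha> \<beta> \<in> carrier_mat n n"
  unfolding W_mat_def using mat_of_cols_carrier(1)[of n "map _ [0..<n]"] by simp

lemma index_V_mat:
  assumes "i < n" "j < n"
  shows "V_mat n \<alpha> $$ (i, j) = coeff ([:\<alpha>, 1:] ^ j) i"
  using assms
  by (simp add: V_mat_def mat_of_cols_index unit_vec_0_eq_coeff J_mat_pow_mult_vec_coeff)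

lemma index_W_mat:
  assumes "i < n" "j < n"
  shows "W_mat n \<alpha> \<beta> $$ (i, j) = coeff ([:\<beta>, 1:] ^ (n - 1 - j) * [:\<alpha>, 1:] ^ j) i"
  using assms
  by (simp add: W_mat_def mat_of_cols_index unit_vec_0_eq_coeff J_mat_pow_mult_vec_coeff
      assoc_mult_mat_vec[of _ n n _ n])

text \<open>For \<open>degree p \<le> m\<close> this is \<open>y ^ m * p(x / y)\<close> without the
  division, so that \<open>y = 0\<close> remains allowed. The target degree is explicit because
  raising it by one costs a factor \<open>y\<close>.\<close>

definition homogenize :: "nat \<Rightarrow> 'a :: comm_ring_1 poly \<Rightarrow> 'a \<Rightarrow> 'a \<Rightarrow> 'a" where
  "homogenize m p x y = (\<Sum>i\<le>m. coeff p i * (x ^ i * y ^ (m - i)))"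

lemma homogenize_Suc:
  assumes "degree p \<le> m"
  shows "homogenize (Suc m) p x y = y * homogenize m p x y"
proof -
  have "coeff p (Suc m) = 0"
    using assms by (simp add: coeff_eq_0)
  then show ?thesis
    by (simp add: homogenize_def sum_distrib_left Suc_diff_le ac_simps)
qed

lemma homogenize_linear_mult:
  assumes "degree p \<le> m"
  shows "homogenize (Suc m) ([:\<alpha>, 1:] * p) x y = (x + \<alpha> * y) * homogenize m p x y"
proof -
  have "homogenize (Suc m) (pCons 0 p) x y = x * homogenize m p x y"
    unfolding homogenize_def by (subst sum.atMost_Suc_shift) (simp add: sum_distrib_left ac_simps)
  moreover have "homogenize (Suc m) ([:\<alpha>, 1:] * p) x y =
      \<alpha> * homogenize (Suc m) p x y + homogenize (Suc m) (pCons 0 p) x y"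
    by (simp add: homogenize_def algebra_simps sum.distrib sum_distrib_left)
  ultimately show ?thesis
    by (simp add: homogenize_Suc[OF assms] algebra_simps)
qed

lemma degree_linear_power_mult:
  "degree ([:\<alpha>, 1:] ^ k * p) \<le> k + degree (p :: 'a :: comm_ring_1 poly)"
  by (rule order.trans[OF degree_mult_le]) (simp add: degree_linear_power)

lemma homogenize_linear_power_mult:
  assumes "degree p \<le> m"
  shows "homogenize (k + m) ([:\<alpha>, 1:] ^ k * p) x y = (x + \<alpha> * y) ^ k * homogenize m p x y"
proof (induction k)
  case (Suc k)
  have "degree ([:\<alpha>, 1:] ^ k * p) \<le> k + m"
    using degree_linear_power_mult[of \<alpha> k p] assms by linarith
  from homogenize_linear_mult[OF this, of \<alpha> x y] show ?case
    by (simp only: Suc power_Suc add_Suc mult.assoc)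
qed simp

lemma homogenize_raise:
  assumes "degree p \<le> m"
  shows "homogenize (k + m) p x y = y ^ k * homogenize m p x y"
proof (induction k)
  case (Suc k)
  then show ?case
    using homogenize_Suc[of p "k + m" x y] assms by (simp add: mult.assoc)
qed simp

lemma homogenize_0_1 [simp]: "homogenize 0 1 x y = 1"
  by (simp add: homogenize_def)

text \<open>Column \<open>j\<close> is a polynomial of degree \<open>j\<close> homogenized to degree
  \<open>n - 1\<close>; the excess \<open>n - 1 - j\<close> becomes the power of
  \<open>y\<close>.\<close>

lemma V_mat_columns:
  assumes "j < n"
  shows "(\<Sum>i<n. V_mat n \<alpha> $$ (i, j) * (x ^ i * y ^ (n - 1 - i))) = (x + \<alpha> * y) ^ j * y ^ (n - 1 - j)"
proof -
  have "(\<Sum>i<n. V_mat n \<alpha> $$ (i, j) * (x ^ i * y ^ (n - 1 - i))) =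
      homogenize (n - 1) ([:\<alpha>, 1:] ^ j) x y"
    unfolding homogenize_def using assms by (intro sum.cong) (auto simp: index_V_mat)
  also have "\<dots> = homogenize ((n - 1 - j) + j) ([:\<alpha>, 1:] ^ j) x y"
    using assms by simp
  also have "\<dots> = y ^ (n - 1 - j) * homogenize (j + 0) ([:\<alpha>, 1:] ^ j * 1) x y"
    by (subst homogenize_raise) (simp_all add: degree_linear_power)
  also have "\<dots> = y ^ (n - 1 - j) * (x + \<alpha> * y) ^ j"
    by (subst homogenize_linear_power_mult) simp_all
  finally show ?thesis
    by (simp add: mult.commute)
qed

lemma W_mat_columns:
  assumes "j < n"
  shows "(\<Sum>i<n. W_mat n \<alpha> \<beta> $$ (i, j) * (x ^ i * y ^ (n - 1 - i))) =
    (x + \<alpha> * y) ^ j * (x + \<beta> * y) ^ (n - 1 - j)"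
proof -
  have "(\<Sum>i<n. W_mat n \<alpha> \<beta> $$ (i, j) * (x ^ i * y ^ (n - 1 - i))) =
      homogenize (n - 1) ([:\<beta>, 1:] ^ (n - 1 - j) * [:\<alpha>, 1:] ^ j) x y"
    unfolding homogenize_def using assms by (intro sum.cong) (auto simp: index_W_mat)
  also have "\<dots> = homogenize ((n - 1 - j) + j) ([:\<beta>, 1:] ^ (n - 1 - j) * [:\<alpha>, 1:] ^ j) x y"
    using assms by simp
  also have "\<dots> = (x + \<beta> * y) ^ (n - 1 - j) * homogenize (j + 0) ([:\<alpha>, 1:] ^ j * 1) x y"
    by (subst homogenize_linear_power_mult) (simp_all add: degree_linear_power)
  also have "\<dots> = (x + \<beta> * y) ^ (n - 1 - j) * (x + \<alpha> * y) ^ j"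
    by (subst homogenize_linear_power_mult) simp_all
  finally show ?thesis
    by (simp add: mult.commute)
qed

text \<open>The row vector \<open>(x\<^sup>i y\<^bsup>n-1-i\<^esup>)\<^sub>i\<close> is mapped by \<open>N\<close> to \<open>(f\<^sup>j g\<^bsup>n-1-j\<^esup>)\<^sub>j\<close>. Since the rank one Toeplitz
  matrix \<open>[x\<^bsup>n-1-i+j\<^esup> y\<^bsup>n-1+i-j\<^esup>]\<close> is the outer product of this vector with its reversal, the map
  \<open>A \<mapsto> M A N\<close> then sends \<open>(x, y)\<close> to \<open>(f, g)\<close>.\<close>

definition column_values :: "nat \<Rightarrow> 'a :: comm_ring_1 mat \<Rightarrow> 'a \<Rightarrow> 'a \<Rightarrow> 'a \<Rightarrow> 'a \<Rightarrow> bool" where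
  "column_values n N x y f g \<longleftrightarrow>
     (\<forall>j<n. (\<Sum>i<n. N $$ (i, j) * (x ^ i * y ^ (n - 1 - i))) = f ^ j * g ^ (n - 1 - j))"

section \<open>The map \<open>A \<mapsto> M * A * N\<close> on generators\<close>

lemma sandwich_carrier:
  assumes "N \<in> carrier_mat n n" "M = \<gamma> \<cdot>\<^sub>m (F_mat n * transpose_mat N * F_mat n)"
  shows "M \<in> carrier_mat n n"
  using assms by (auto simp del: smult_carrier_mat intro!: smult_carrier_mat mult_carrier_mat[of _ n n])

text \<open>The flips in \<open>M\<close> reverse the row index and turn the Toeplitz matrix into
  the Hankel matrix of \<open>v (p + q)\<close>: the entry is its bilinear form in columns
  \<open>n - 1 - i\<close> and \<open>j\<close> of \<open>N\<close>, scaled by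
  \<open>\<gamma>\<close>.\<close>

lemma index_sandwich:
  assumes N: "N \<in> carrier_mat n n" and M: "M = \<gamma> \<cdot>\<^sub>m (F_mat n * transpose_mat N * F_mat n)"
    and ij: "i < n" "j < n"
  shows "(M * toep n v * N) $$ (i, j) =
    (\<Sum>q<n. \<Sum>p<n. \<gamma> * N $$ (p, n - 1 - i) * v (p + q) * N $$ (q, j))"
proof -
  have FN: "F_mat n * transpose_mat N \<in> carrier_mat n n"
    using N by (auto intro!: mult_carrier_mat[of _ n n])
  have FNF: "F_mat n * transpose_mat N * F_mat n \<in> carrier_mat n n"
    by (rule mult_carrier_mat[OF FN]) simp
  have "M $$ (i, p) = \<gamma> * N $$ (n - 1 - p, n - 1 - i)" if "p < n" for p
  proof -
    have "M $$ (i, p) = \<gamma> * (F_mat n * transpose_mat N * F_mat n) $$ (i, p)"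
      unfolding M using FNF ij that by (subst index_smult_mat) auto
    also have "(F_mat n * transpose_mat N * F_mat n) $$ (i, p) = transpose_mat N $$ (n - 1 - i, n - 1 - p)"
      using ij that N by (subst index_mult_F_mat[OF FN]) (simp_all add: index_F_mat_mult del: index_mult_mat)
    finally show ?thesis
      using ij that N by simp
  qed
  then have "(M * toep n v) $$ (i, q) = (\<Sum>p<n. \<gamma> * N $$ (n - 1 - p, n - 1 - i) * v (n - 1 - p + q))"
    if "q < n" for q
    using that ij by (simp add: index_mult_mat_sum[OF sandwich_carrier[OF N M] toep_carrier] index_toep
        del: index_mult_mat)
  also have "(\<Sum>p<n. \<gamma> * N $$ (n - 1 - p, n - 1 - i) * v (n - 1 - p + q)) =
      (\<Sum>p<n. \<gamma> * N $$ (p, n - 1 - i) * v (p + q))" for q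
    by (rule sum.reindex_bij_witness[of _ "\<lambda>p. n - 1 - p" "\<lambda>p. n - 1 - p"]) auto
  finally have "(M * toep n v) $$ (i, q) = (\<Sum>p<n. \<gamma> * N $$ (p, n - 1 - i) * v (p + q))"
    if "q < n" for q
    using that .
  then show ?thesis
    using ij by (subst index_mult_mat_sum[OF mult_carrier_mat[OF sandwich_carrier[OF N M] toep_carrier] N])
      (simp_all add: sum_distrib_right)
qed

lemma sandwich_veronese:
  assumes N: "N \<in> carrier_mat n n" and M: "M = \<gamma> \<cdot>\<^sub>m (F_mat n * transpose_mat N * F_mat n)"
    and cols: "column_values n N x y f g"
  shows "M * toep n (\<lambda>k. x ^ k * y ^ (2 * n - 2 - k)) * N =
    toep n (\<lambda>k. \<gamma> * (f ^ k * g ^ (2 * n - 2 - k)))"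
proof (rule eq_matI)
  fix i j assume "i < dim_row (toep n (\<lambda>k. \<gamma> * (f ^ k * g ^ (2 * n - 2 - k))))"
    "j < dim_col (toep n (\<lambda>k. \<gamma> * (f ^ k * g ^ (2 * n - 2 - k))))"
  then have ij: "i < n" "j < n"
    by simp_all
  have "(M * toep n (\<lambda>k. x ^ k * y ^ (2 * n - 2 - k)) * N) $$ (i, j) =
      (\<Sum>q<n. \<Sum>p<n. \<gamma> * (N $$ (p, n - 1 - i) * (x ^ p * y ^ (n - 1 - p))) *
        (N $$ (q, j) * (x ^ q * y ^ (n - 1 - q))))"
  proof (unfold index_sandwich[OF N M ij], intro sum.cong refl)
    fix p q assume "p \<in> {..<n}" "q \<in> {..<n}"
    then have "2 * n - 2 - (p + q) = (n - 1 - p) + (n - 1 - q)"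
      by auto
    then show "\<gamma> * N $$ (p, n - 1 - i) * (x ^ (p + q) * y ^ (2 * n - 2 - (p + q))) * N $$ (q, j) =
        \<gamma> * (N $$ (p, n - 1 - i) * (x ^ p * y ^ (n - 1 - p))) *
          (N $$ (q, j) * (x ^ q * y ^ (n - 1 - q)))"
      by (simp only: power_add ac_simps)
  qed
  \<comment> \<open>The double sum is now a product of column sums, evaluated by
    \<open>column_values\<close> at \<open>n - 1 - i\<close> and \<open>j\<close>.\<close>
  also have "\<dots> = \<gamma> * (f ^ (n - 1 - i) * g ^ (n - 1 - (n - 1 - i))) * (f ^ j * g ^ (n - 1 - j))"
  proof -
    have "(\<Sum>i<n. N $$ (i, l) * (x ^ i * y ^ (n - 1 - i))) = f ^ l * g ^ (n - 1 - l)" if "l < n" for l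
      using cols that by (simp add: column_values_def)
    moreover have "n - 1 - i < n"
      using ij by simp
    ultimately show ?thesis
      using ij(2) by (simp only: sum_distrib_left[symmetric] sum_distrib_right[symmetric])
  qed
  also have "\<dots> = \<gamma> * (f ^ (n - 1 - i + j) * g ^ (2 * n - 2 - (n - 1 - i + j)))"
  proof -
    have "2 * n - 2 - (n - 1 - i + j) = (n - 1 - (n - 1 - i)) + (n - 1 - j)"
      using ij by simp
    then show ?thesis
      by (simp only: power_add ac_simps)
  qed
  finally show "(M * toep n (\<lambda>k. x ^ k * y ^ (2 * n - 2 - k)) * N) $$ (i, j) =
      toep n (\<lambda>k. \<gamma> * (f ^ k * g ^ (2 * n - 2 - k))) $$ (i, j)"
    using ij by (simp add: index_toep)
qed (use sandwich_carrier[OF N M] N in auto)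

lemma coord_linear_sandwich:
  assumes N: "N \<in> carrier_mat n n" and M: "M = \<gamma> \<cdot>\<^sub>m (F_mat n * transpose_mat N * F_mat n)"
    and ij: "i < n" "j < n"
  shows "coord_linear (2 * n - 2) (\<lambda>v. (M * toep n v * N) $$ (i, j))"
  unfolding coord_linear_def index_sandwich[OF N M ij]
  by (auto simp: algebra_simps sum.distrib sum_distrib_left intro!: sum.cong)

section \<open>Standard factors and invertible linear substitutions\<close>

definition standard_factor :: "nat \<Rightarrow> 'a :: field \<Rightarrow> 'a mat \<Rightarrow> bool" where
  "standard_factor n r N \<longleftrightarrow>
     (\<exists>\<alpha>. N = V_mat n \<alpha> * D_mat n r) \<or> (\<exists>\<alpha>. N = V_mat n \<alpha> * F_mat n * D_mat n r) \<or>
     (\<exists>\<alpha> \<beta>. \<alpha> \<noteq> \<beta> \<and> N = W_mat n \<alpha> \<beta> * D_mat n r)"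

lemma standard_form_iff:
  "standard_form n T \<longleftrightarrow>
     (\<exists>\<gamma> r M N. \<gamma> \<noteq> 0 \<and> r \<noteq> 0 \<and> (\<forall>A \<in> toeplitz_space n. T A = M * A * N) \<and>
        M = \<gamma> \<cdot>\<^sub>m (F_mat n * transpose_mat N * F_mat n) \<and> standard_factor n r N)"
  unfolding standard_form_def standard_factor_def ..

lemma index_VFD:
  assumes "i < n" "j < n"
  shows "(V_mat n \<alpha> * F_mat n * D_mat n r) $$ (i, j) = V_mat n \<alpha> $$ (i, n - 1 - j) * r ^ j"
proof -
  have "V_mat n \<alpha> * F_mat n \<in> carrier_mat n n"
    by (rule mult_carrier_mat[of _ n n]) simp_all
  from index_mult_D_mat[OF this assms] show ?thesis
    by (simp only: index_mult_F_mat[OF V_mat_carrier assms])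
qed

text \<open>Covers the right factor \<open>D_mat\<close>, whose \<open>r ^ j\<close> is absorbed
  into \<open>f ^ j\<close>; \<open>\<sigma>\<close> is the identity, or the reversal caused by
  \<open>F_mat\<close>.\<close>

lemma column_values_scaled:
  assumes "\<And>i j. i < n \<Longrightarrow> j < n \<Longrightarrow> N $$ (i, j) = N' $$ (i, \<sigma> j) * r ^ j"
    and "\<And>j. j < n \<Longrightarrow> (\<Sum>i<n. N' $$ (i, \<sigma> j) * (x ^ i * y ^ (n - 1 - i))) = f ^ j * g ^ (n - 1 - j)"
  shows "column_values n N x y (r * f) g"
  unfolding column_values_def
proof (intro allI impI)
  fix j assume j: "j < n"
  have "(\<Sum>i<n. N $$ (i, j) * (x ^ i * y ^ (n - 1 - i))) =
      r ^ j * (\<Sum>i<n. N' $$ (i, \<sigma> j) * (x ^ i * y ^ (n - 1 - i)))"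
    unfolding sum_distrib_left using j by (intro sum.cong refl) (simp add: assms(1) ac_simps)
  then show "(\<Sum>i<n. N $$ (i, j) * (x ^ i * y ^ (n - 1 - i))) = (r * f) ^ j * g ^ (n - 1 - j)"
    unfolding assms(2)[OF j] by (simp add: power_mult_distrib ac_simps)
qed

lemma VD_columns: "column_values n (V_mat n \<alpha> * D_mat n r) x y (r * (x + \<alpha> * y)) y"
  by (rule column_values_scaled[where \<sigma> = "\<lambda>j. j"])
    (rule index_mult_D_mat[OF V_mat_carrier] V_mat_columns, assumption+)+

lemma VFD_columns: "column_values n (V_mat n \<alpha> * F_mat n * D_mat n r) x y (r * y) (x + \<alpha> * y)"
proof (rule column_values_scaled[where \<sigma> = "\<lambda>j. n - 1 - j", OF index_VFD])
  fix j assume "j < n"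
  then have "n - 1 - j < n" "n - 1 - (n - 1 - j) = j"
    by auto
  then show "(\<Sum>i<n. V_mat n \<alpha> $$ (i, n - 1 - j) * (x ^ i * y ^ (n - 1 - i))) =
      y ^ j * (x + \<alpha> * y) ^ (n - 1 - j)"
    using V_mat_columns[of "n - 1 - j" n \<alpha> x y] by (simp only: mult.commute)
qed

lemma WD_columns:
  "column_values n (W_mat n \<alpha> \<beta> * D_mat n r) x y (r * (x + \<alpha> * y)) (x + \<beta> * y)"
  by (rule column_values_scaled[where \<sigma> = "\<lambda>j. j"])
    (rule index_mult_D_mat[OF W_mat_carrier] W_mat_columns, assumption+)+

text \<open>The determinants \<open>a * d - b * c\<close> of the three substitutions are
  \<open>r\<close>, \<open>- r\<close> and \<open>r * (\<beta> - \<alpha>)\<close>.\<close>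

lemma standard_factor_columns:
  assumes "standard_factor n r N" "r \<noteq> 0"
  obtains a b c d where "N \<in> carrier_mat n n" "a * d \<noteq> b * c"
    "\<forall>x y. column_values n N x y (a * x + b * y) (c * x + d * y)"
proof -
  consider (V) \<alpha> where "N = V_mat n \<alpha> * D_mat n r"
    | (VF) \<alpha> where "N = V_mat n \<alpha> * F_mat n * D_mat n r"
    | (W) \<alpha> \<beta> where "\<alpha> \<noteq> \<beta>" "N = W_mat n \<alpha> \<beta> * D_mat n r"
    using assms(1) unfolding standard_factor_def by blast
  then show thesis
  proof cases
    case V
    show thesis
    proof (rule that[of r 1 "r * \<alpha>" 0])
      show "\<forall>x y. column_values n N x y (r * x + r * \<alpha> * y) (0 * x + 1 * y)"
        using VD_columns[of n \<alpha> r] by (simp add: V algebra_simps)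
    qed (use V assms in \<open>auto intro!: mult_carrier_mat[of _ n n]\<close>)
  next
    case VF
    show thesis
    proof (rule that[of 0 \<alpha> r 1])
      show "\<forall>x y. column_values n N x y (0 * x + r * y) (1 * x + \<alpha> * y)"
        using VFD_columns[of n \<alpha> r] by (simp add: VF)
    qed (use VF assms in \<open>auto intro!: mult_carrier_mat[of _ n n]\<close>)
  next
    case W
    show thesis
    proof (rule that[of r \<beta> "r * \<alpha>" 1])
      show "\<forall>x y. column_values n N x y (r * x + r * \<alpha> * y) (1 * x + \<beta> * y)"
        using WD_columns[of n \<alpha> \<beta> r] by (simp add: W(2) algebra_simps)
    qed (use W assms in \<open>auto intro!: mult_carrier_mat[of _ n n]\<close>)
  qed
qed

text \<open>Dividing by \<open>s\<close> normalizes the second form: \<open>s = d\<close> makes it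
  constant 1 if \<open>c = 0\<close>, and \<open>s = c\<close> makes it monic otherwise. Then
  \<open>a = 0\<close> separates the flipped form from the \<open>W_mat\<close> form, whose
  parameters differ because the determinant is nonzero.\<close>

lemma standard_factor_exists:
  fixes a b c d :: "'a :: field"
  assumes det: "a * d \<noteq> b * c"
  obtains r s N where "r \<noteq> 0" "s \<noteq> 0" "standard_factor n r N" "N \<in> carrier_mat n n"
    "\<And>x. column_values n N x 1 ((a * x + b) / s) ((c * x + d) / s)"
proof -
  consider "c = 0" | "a = 0" "c \<noteq> 0" | "a \<noteq> 0" "c \<noteq> 0"
    by blast
  then show thesis
  proof cases
    case 1
    let ?N = "V_mat n (b / a) * D_mat n (a / d)"
    have nz: "a \<noteq> 0" "d \<noteq> 0"
      using 1 det by auto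
    have eq: "a / d * (x + b / a * 1) = (a * x + b) / d" "(c * x + d) / d = 1" for x
      using nz 1 by (simp_all add: field_simps)
    show thesis
    proof (rule that[of "a / d" d ?N])
      show "column_values n ?N x 1 ((a * x + b) / d) ((c * x + d) / d)" for x
        using VD_columns[of n "b / a" "a / d" x 1] by (simp only: eq)
    qed (use nz in \<open>auto simp: standard_factor_def intro!: mult_carrier_mat[of _ n n]\<close>)
  next
    case 2
    let ?N = "V_mat n (d / c) * F_mat n * D_mat n (b / c)"
    have nz: "b \<noteq> 0"
      using 2 det by auto
    have eq: "b / c * 1 = (a * x + b) / c" "x + d / c * 1 = (c * x + d) / c" for x
      using nz 2 by (simp_all add: field_simps)
    show thesis
    proof (rule that[of "b / c" c ?N])
      show "column_values n ?N x 1 ((a * x + b) / c) ((c * x + d) / c)" for x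
        using VFD_columns[of n "d / c" "b / c" x 1] by (simp only: eq[of x])
    qed (use nz 2 in \<open>auto simp: standard_factor_def intro!: mult_carrier_mat[of _ n n]\<close>)
  next
    case 3
    let ?N = "W_mat n (b / a) (d / c) * D_mat n (a / c)"
    have eq: "a / c * (x + b / a * 1) = (a * x + b) / c" "x + d / c * 1 = (c * x + d) / c" for x
      using 3 by (simp_all add: field_simps)
    have neq: "b / a \<noteq> d / c"
      using 3 det by (simp add: field_simps)
    show thesis
    proof (rule that[of "a / c" c ?N])
      show "column_values n ?N x 1 ((a * x + b) / c) ((c * x + d) / c)" for x
        using WD_columns[of n "b / a" "d / c" "a / c" x 1] by (simp only: eq)
      show "standard_factor n (a / c) ?N"
        using neq unfolding standard_factor_def by blast
    qed (use 3 in \<open>auto intro!: mult_carrier_mat[of _ n n]\<close>)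
  qed
qed

text \<open>Both maps are linear in the generator, so by \<open>coord_linear_eqI\<close> agreement
  on geometric generators is enough.\<close>

lemma standard_form_if_moebius:
  fixes T :: "'a :: field_char_0 mat \<Rightarrow> 'a mat"
  assumes T: "toeplitz_linear n T" and \<kappa>: "\<kappa> \<noteq> 0" and det: "a * d \<noteq> b * c"
    and eq: "\<And>x. T (toep n (\<lambda>k. x ^ k)) =
        toep n (\<lambda>k. \<kappa> * ((a * x + b) ^ k * (c * x + d) ^ (2 * n - 2 - k)))"
  shows "standard_form n T"
proof -
  obtain r s N where r: "r \<noteq> 0" and s: "s \<noteq> 0" and sf: "standard_factor n r N"
    and N: "N \<in> carrier_mat n n"
    and cols: "\<And>x. column_values n N x 1 ((a * x + b) / s) ((c * x + d) / s)"
    using standard_factor_exists[OF det, of n] by blast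
  \<comment> \<open>The forms enter with total degree \<open>2 * n - 2\<close>, so this power of
    \<open>s\<close> undoes the normalization.\<close>
  define \<gamma> where "\<gamma> = \<kappa> * s ^ (2 * n - 2)"
  define M where "M = \<gamma> \<cdot>\<^sub>m (F_mat n * transpose_mat N * F_mat n)"
  have pow: "T (toep n (\<lambda>k. x ^ k)) = M * toep n (\<lambda>k. x ^ k) * N" for x
  proof -
    have "M * toep n (\<lambda>k. x ^ k) * N = M * toep n (\<lambda>k. x ^ k * 1 ^ (2 * n - 2 - k)) * N"
      by simp
    also have "\<dots> = toep n (\<lambda>k. \<gamma> * (((a * x + b) / s) ^ k * ((c * x + d) / s) ^ (2 * n - 2 - k)))"
      by (rule sandwich_veronese[OF N M_def cols])
    also have "\<dots> = T (toep n (\<lambda>k. x ^ k))"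
      unfolding eq
    proof (rule toep_cong)
      fix k assume "k \<le> 2 * n - 2"
      then have "s ^ (2 * n - 2) = s ^ k * s ^ (2 * n - 2 - k)"
        by (metis le_add_diff_inverse power_add)
      then show "\<gamma> * (((a * x + b) / s) ^ k * ((c * x + d) / s) ^ (2 * n - 2 - k)) =
          \<kappa> * ((a * x + b) ^ k * (c * x + d) ^ (2 * n - 2 - k))"
        using s by (simp add: \<gamma>_def power_divide)
    qed
    finally show ?thesis ..
  qed
  have "T (toep n v) = M * toep n v * N" for v
  proof (rule eq_matI)
    fix i j assume "i < dim_row (M * toep n v * N)" "j < dim_col (M * toep n v * N)"
    then have ij: "i < n" "j < n"
      using sandwich_carrier[OF N M_def] N by auto
    show "T (toep n v) $$ (i, j) = (M * toep n v * N) $$ (i, j)"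
      by (rule coord_linear_eqI[OF coord_linear_toeplitz_linear[OF T ij] coord_linear_sandwich[OF N M_def ij]])
        (simp only: pow)
  qed (use sandwich_carrier[OF N M_def] N toeplitz_linear_carrier[OF T, of v] in auto)
  moreover have "\<gamma> \<noteq> 0"
    using \<kappa> s by (simp add: \<gamma>_def)
  ultimately show ?thesis
    unfolding standard_form_iff toeplitz_space_eq
    by (intro exI[of _ \<gamma>] exI[of _ r] exI[of _ M] exI[of _ N] conjI ballI M_def r sf) auto
qed

text \<open>The map acts on the parameters \<open>(x, y)\<close> by an invertible 2x2 matrix, which
  never sends a nonzero pair to zero.\<close>

lemma preserves_rank_one_if_standard_form:
  fixes T :: "'a :: field mat \<Rightarrow> 'a mat"
  assumes n: "n \<ge> 1" and T: "toeplitz_linear n T" and sf: "standard_form n T"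
  shows "preserves_rank_one n T"
proof -
  obtain \<gamma> r M N where \<gamma>: "\<gamma> \<noteq> 0" and r: "r \<noteq> 0" and TMN: "\<forall>A\<in>toeplitz_space n. T A = M * A * N"
    and M: "M = \<gamma> \<cdot>\<^sub>m (F_mat n * transpose_mat N * F_mat n)" and N: "standard_factor n r N"
    using sf unfolding standard_form_iff by (elim exE conjE) (rule that)
  obtain a b c d where Nc: "N \<in> carrier_mat n n" and det: "a * d \<noteq> b * c"
    and cols: "\<forall>x y. column_values n N x y (a * x + b * y) (c * x + d * y)"
    using standard_factor_columns[OF N r] .
  show ?thesis
    unfolding preserves_rank_one_def toeplitz_space_eq
  proof clarify
    fix v :: "nat \<Rightarrow> 'a" assume "rank_one n (toep n v)"
    then obtain e x y where e: "e \<noteq> 0" and xy: "x \<noteq> 0 \<or> y \<noteq> 0"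
      and v: "\<And>k. k \<le> 2 * n - 2 \<Longrightarrow> v k = e * (x ^ k * y ^ (2 * n - 2 - k))"
      unfolding rank_one_toep_iff[OF n] by blast
    let ?f = "a * x + b * y" and ?g = "c * x + d * y"
    have "toep n v = e \<cdot>\<^sub>m toep n (\<lambda>k. x ^ k * y ^ (2 * n - 2 - k))"
      unfolding toep_smult[symmetric] by (rule toep_cong) (rule v)
    then have "T (toep n v) = e \<cdot>\<^sub>m (M * toep n (\<lambda>k. x ^ k * y ^ (2 * n - 2 - k)) * N)"
      using T TMN unfolding toeplitz_linear_def toeplitz_space_eq by auto
    also have "\<dots> = toep n (\<lambda>k. e * (\<gamma> * (?f ^ k * ?g ^ (2 * n - 2 - k))))"
      unfolding sandwich_veronese[OF Nc M cols[rule_format]] toep_smult ..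
    finally have Tv: "T (toep n v) = toep n (\<lambda>k. e * (\<gamma> * (?f ^ k * ?g ^ (2 * n - 2 - k))))" .
    have "?f \<noteq> 0 \<or> ?g \<noteq> 0"
    proof (rule ccontr)
      assume "\<not> ?thesis"
      \<comment> \<open>Cramer's rule: these combinations isolate \<open>x\<close> and
        \<open>y\<close>, each multiplied by the determinant.\<close>
      then have "d * ?f - b * ?g = 0" "a * ?g - c * ?f = 0"
        by auto
      then have "(a * d - b * c) * x = 0" "(a * d - b * c) * y = 0"
        by (simp_all add: algebra_simps)
      with det xy show False
        by simp
    qed
    moreover have "e * \<gamma> \<noteq> 0"
      using e \<gamma> by simp
    ultimately show "rank_one n (T (toep n v))"
      unfolding Tv rank_one_toep_iff[OF n] mult.assoc[symmetric, of e]
      by (intro exI[of _ "e * \<gamma>"] exI[of _ ?f] exI[of _ ?g] conjI) simp_all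
  qed
qed

section \<open>The functional form and the classification\<close>

lemma standard_form_or_functional:
  fixes T :: "'a :: {field_char_0, field_gcd} mat \<Rightarrow> 'a mat"
  assumes n: "n \<ge> 1" and T: "toeplitz_linear n T" and pres: "preserves_rank_one n T"
  obtains (standard) "standard_form n T"
  | (functional) h B where "n \<ge> 2" "degree h \<le> 2 * n - 2" "coeff h (2 * n - 2) \<noteq> 0"
      "\<And>x. poly h x \<noteq> 0" "B \<in> toeplitz_space n" "rank_one n B"
      "\<And>v. T (toep n v) = (\<Sum>j\<le>2 * n - 2. v j * coeff h j) \<cdot>\<^sub>m B"
  using n T pres
proof (cases rule: preserves_rank_one_cases)
  case (moebius \<kappa> a b c d)
  from standard standard_form_if_moebius[OF T moebius] show thesis .
next
  case *: (functional h B)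
  from functional[OF *] show thesis .
qed

text \<open>The diagonal \<open>n - j\<close> sits at position \<open>j - 1\<close> of the
  generator, whence the index shift.\<close>

lemma toeplitz_functional_toep:
  assumes "n \<ge> 1"
  shows "toeplitz_functional n c (toep n v) = (\<Sum>j\<le>2 * n - 2. c (j + 1) * v j)"
proof -
  have "toeplitz_functional n c (toep n v) = (\<Sum>j = 1..2 * n - 1. c j * v (j - 1))"
    unfolding toep_def toeplitz_functional_toeplitz_mat[OF assms]
    by (intro sum.cong refl) (auto intro!: arg_cong[of _ _ v])
  also have "\<dots> = (\<Sum>j\<le>2 * n - 2. c (j + 1) * v j)"
    using assms by (intro sum.reindex_bij_witness[of _ "\<lambda>j. j + 1" "\<lambda>j. j - 1"]) auto
  finally show ?thesis .
qed

text \<open>For \<open>y \<noteq> 0\<close>, dividing by a power of \<open>y\<close> gives the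
  admissibility polynomial at \<open>x / y\<close>; for \<open>y = 0\<close> only the last
  coefficient remains.\<close>

lemma admissible_nonzero:
  assumes n: "n \<ge> 1" and c: "admissible n c" and xy: "x \<noteq> 0 \<or> y \<noteq> 0"
  shows "(\<Sum>j\<le>2 * n - 2. c (j + 1) * (x ^ j * y ^ (2 * n - 2 - j))) \<noteq> 0"
proof (cases "y = 0")
  case True
  have "2 * n - 2 + 1 = 2 * n - 1"
    using n by simp
  then have "(\<Sum>j\<le>2 * n - 2. c (j + 1) * (x ^ j * y ^ (2 * n - 2 - j))) =
      (\<Sum>j\<le>2 * n - 2. if j = 2 * n - 2 then c (2 * n - 1) * x ^ (2 * n - 2) else 0)"
    using True by (intro sum.cong refl) (auto simp: power_0_left)
  also have "\<dots> = c (2 * n - 1) * x ^ (2 * n - 2)"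
    by simp
  finally show ?thesis
    using c xy True by (simp add: admissible_def)
next
  case False
  have "(\<Sum>j\<le>2 * n - 2. c (j + 1) * (x ^ j * y ^ (2 * n - 2 - j))) =
      y ^ (2 * n - 2) * (\<Sum>j = 0..2 * n - 2. c (j + 1) * (x / y) ^ j)"
    unfolding sum_distrib_left atMost_atLeast0
  proof (intro sum.cong refl)
    fix j assume "j \<in> {0..2 * n - 2}"
    then have "y ^ (2 * n - 2) = y ^ j * y ^ (2 * n - 2 - j)"
      by (metis atLeastAtMost_iff le_add_diff_inverse power_add)
    then show "c (j + 1) * (x ^ j * y ^ (2 * n - 2 - j)) = y ^ (2 * n - 2) * (c (j + 1) * (x / y) ^ j)"
      using False by (simp add: power_divide)
  qed
  then show ?thesis
    using c False by (simp add: admissible_def del: sum.atMost_Suc)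
qed

text \<open>The functional does not vanish on rank one generators, so the image is a nonzero
  multiple of \<open>B\<close>.\<close>

lemma preserves_rank_one_if_functional:
  assumes n: "n \<ge> 1" and B: "B \<in> toeplitz_space n" "rank_one n B" and c: "admissible n c"
    and T: "\<forall>A \<in> toeplitz_space n. T A = toeplitz_functional n c A \<cdot>\<^sub>m B"
  shows "preserves_rank_one n T"
  unfolding preserves_rank_one_def toeplitz_space_eq
proof clarify
  fix v :: "nat \<Rightarrow> real" assume "rank_one n (toep n v)"
  then obtain e x y where e: "e \<noteq> 0" and xy: "x \<noteq> 0 \<or> y \<noteq> 0"
    and v: "\<And>k. k \<le> 2 * n - 2 \<Longrightarrow> v k = e * (x ^ k * y ^ (2 * n - 2 - k))"
    unfolding rank_one_toep_iff[OF n] by blast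
  have "toeplitz_functional n c (toep n v) =
      e * (\<Sum>j\<le>2 * n - 2. c (j + 1) * (x ^ j * y ^ (2 * n - 2 - j)))"
    unfolding toeplitz_functional_toep[OF n] sum_distrib_left
    by (intro sum.cong refl) (simp add: v)
  with admissible_nonzero[OF n c xy] e have nz: "toeplitz_functional n c (toep n v) \<noteq> 0"
    by simp
  obtain w where w: "B = toep n w"
    using B(1) by (auto simp: toeplitz_space_eq)
  obtain e' x' y' where e': "e' \<noteq> 0" and xy': "x' \<noteq> 0 \<or> y' \<noteq> 0"
    and w': "\<And>k. k \<le> 2 * n - 2 \<Longrightarrow> w k = e' * (x' ^ k * y' ^ (2 * n - 2 - k))"
    using B(2) unfolding w rank_one_toep_iff[OF n] by blast
  have "rank_one n (toep n (\<lambda>k. toeplitz_functional n c (toep n v) * w k))"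
    unfolding rank_one_toep_iff[OF n] using nz e' xy'
    by (intro exI[of _ "toeplitz_functional n c (toep n v) * e'"] exI[of _ x'] exI[of _ y'])
      (simp add: w')
  then show "rank_one n (T (toep n v))"
    using T by (simp add: toep_smult w toeplitz_space_eq)
qed

theorem theorem3p6:
  fixes n :: nat
  assumes "n \<ge> 1"
  shows "(\<forall>T :: real mat \<Rightarrow> real mat. toeplitz_linear n T \<longrightarrow>
            (preserves_rank_one n T \<longleftrightarrow>
               standard_form n T \<or>
               (\<exists>B c. B \<in> toeplitz_space n \<and> rank_one n B \<and> admissible n c \<and>
                  (\<forall>A \<in> toeplitz_space n. T A = toeplitz_functional n c A \<cdot>\<^sub>m B)))) \<and>
         (\<forall>T :: complex mat \<Rightarrow> complex mat. toeplitz_linear n T \<longrightarrow>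
            (preserves_rank_one n T \<longleftrightarrow> standard_form n T))"
proof (intro conjI allI impI)
  fix T :: "real mat \<Rightarrow> real mat"
  assume T: "toeplitz_linear n T"
  let ?functional = "\<exists>B c. B \<in> toeplitz_space n \<and> rank_one n B \<and> admissible n c \<and>
    (\<forall>A \<in> toeplitz_space n. T A = toeplitz_functional n c A \<cdot>\<^sub>m B)"
  show "preserves_rank_one n T \<longleftrightarrow> standard_form n T \<or> ?functional"
  proof
    assume "preserves_rank_one n T"
    with assms T show "standard_form n T \<or> ?functional"
    proof (cases rule: standard_form_or_functional)
      case (functional h B)
      \<comment> \<open>Coefficient vectors are indexed from 1, polynomial coefficients from
        0.\<close>
      let ?c = "\<lambda>j. coeff h (j - 1)"
      have "(\<Sum>j = 0..2 * n - 2. ?c (j + 1) * x ^ j) = poly h x" for x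
        using poly_sum_monom[where m = "2 * n - 2" and c = "coeff h" and x = x]
        by (simp add: poly_as_sum_of_monoms'[OF functional(2)] flip: atMost_atLeast0)
      then have "admissible n ?c"
        using functional(3,4) by (simp add: admissible_def numeral_2_eq_2)
      moreover have "\<forall>A \<in> toeplitz_space n. T A = toeplitz_functional n ?c A \<cdot>\<^sub>m B"
        by (auto simp: toeplitz_space_eq functional(7) toeplitz_functional_toep[OF assms] mult.commute)
      ultimately show ?thesis
        using functional(5,6) by blast
    qed simp
  next
    assume "standard_form n T \<or> ?functional"
    then show "preserves_rank_one n T"
      using preserves_rank_one_if_standard_form[OF assms T]
        preserves_rank_one_if_functional[OF assms] by blast
  qed
next
  fix T :: "complex mat \<Rightarrow> complex mat"
  assume T: "toeplitz_linear n T"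
  show "preserves_rank_one n T \<longleftrightarrow> standard_form n T"
  proof
    assume "preserves_rank_one n T"
    with assms T show "standard_form n T"
    proof (cases rule: standard_form_or_functional)
      case (functional h B)
      \<comment> \<open>Since \<open>n \<ge> 2\<close>, the nonzero coefficient at
        \<open>2 * n - 2\<close> makes \<open>h\<close> nonconstant, so it has a complex root and
        this case is void.\<close>
      have "degree h \<noteq> 0"
        using le_degree[OF functional(3)] functional(1) by linarith
      then have "\<not> constant (poly h)"
        by (simp add: constant_degree)
      then show ?thesis
        using fundamental_theorem_of_algebra functional(4) by blast
    qed simp
  qed (rule preserves_rank_one_if_standard_form[OF assms T])
qed

end
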